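(* Let $n\in\mathbb{N}$ and let $A=(\tau_{ij})_{1\le i\le n,\ j\ge 1}$ be an $n\times\infty$ real random matrix with centered entries having joint Gaussian distribution, whose rows are almost surely square-summable (so that the $n\times n$ matrix $AA^T$ is well defined). Suppose that for each $k\le n$, $$d_k:=\inf_{(\alpha_{ij})}\mathbb{E}\Big(\tau_{kk}-\sum_{\min(i,j)<k}\alpha_{ij}\tau_{ij}\Big)^2>0 .$$ For $\varepsilon>0$ put $$\varepsilon_0=\frac{\varepsilon}{\prod_{i=1}^{n}d_i^{1/2}},$$ and let $X_1,\dots,X_n$ be i.i.d. $N(0,1)$-distributed random variables. Then, for $n$ fixed and all sufficiently small $\varepsilon>0$, $$\mathbb{P}\big(\sqrt{\det AA^T}<\varepsilon\big)\le \mathbb{P}\Big(\prod_{j=1}^n |X_j|\le \varepsilon_0\Big),$$ and, as $\varepsilon\to0^+$, $$\mathbb{P}\Big(\prod_{j=1}^n |X_j|\le \varepsilon_0\Big)\sim \Big(\frac{2}{\sqrt{2\pi}}\Big)^n\varepsilon_0\,\frac{|\log\varepsilon_0|^{n-1}}{(n-1)!}.$$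
   Context: $\mathbb{N}=\{1,2,\dots\}$. The $(i,l)$ entry of $AA^T$ is $\sum_{j=1}^\infty \tau_{ij}\tau_{lj}$. In the infimum defining $d_k$, $(\alpha_{ij})$ ranges over real coefficient families indexed by pairs $(i,j)$ with $1\le i\le n$, $j\ge1$, $\min(i,j)<k$, with only finitely many nonzero coefficients; for $k=1$ the sum is empty, so $d_1=\mathbb{E}\tau_{11}^2$. The notation $f(\varepsilon)\sim g(\varepsilon)$ means $f(\varepsilon)/g(\varepsilon)\to1$. *)

theory Defs
  imports
    "HOL-Probability.Probability"
    "HOL-Library.Landau_Symbols"
    "Jordan_Normal_Form.Determinant"
begin

(* Degenerate (almost surely constant) variables count as Gaussian, as they must for
   finite linear combinations of a jointly Gaussian family. *)
definition gaussian_rv :: "'a measure \<Rightarrow> ('a \<Rightarrow> real) \<Rightarrow> bool" where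
  "gaussian_rv M Y \<longleftrightarrow> Y \<in> borel_measurable M \<and>
     (\<exists>\<mu> \<sigma>. (0 < \<sigma> \<and> distributed M lborel Y (\<lambda>x. ennreal (normal_density \<mu> \<sigma> x))) \<or>
            (\<sigma> = 0 \<and> (AE \<omega> in M. Y \<omega> = \<mu>)))"

definition jointly_gaussian :: "'a measure \<Rightarrow> 'i set \<Rightarrow> ('i \<Rightarrow> 'a \<Rightarrow> real) \<Rightarrow> bool" where
  "jointly_gaussian M I Y \<longleftrightarrow>
     (\<forall>J c. finite J \<and> J \<subseteq> I \<longrightarrow> gaussian_rv M (\<lambda>\<omega>. \<Sum>i\<in>J. c i * Y i \<omega>))"

(* The matrix entries are tau i j with 1 <= i <= n and 1 <= j; values of tau at other
   indices are never used. Matrices in Jordan_Normal_Form are indexed from 0, hence the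
   successors. *)
definition gram_matrix :: "nat \<Rightarrow> (nat \<Rightarrow> nat \<Rightarrow> 'a \<Rightarrow> real) \<Rightarrow> 'a \<Rightarrow> real mat" where
  "gram_matrix n \<tau> \<omega> =
     Matrix.mat n n (\<lambda>(i, l). \<Sum>j. \<tau> (Suc i) (Suc j) \<omega> * \<tau> (Suc l) (Suc j) \<omega>)"

definition hook_indices :: "nat \<Rightarrow> nat \<Rightarrow> (nat \<times> nat) set" where
  "hook_indices n k = {(i, j). 1 \<le> i \<and> i \<le> n \<and> 1 \<le> j \<and> min i j < k}"

definition hook_dist ::
  "'a measure \<Rightarrow> nat \<Rightarrow> (nat \<Rightarrow> nat \<Rightarrow> 'a \<Rightarrow> real) \<Rightarrow> nat \<Rightarrow> real" where
  "hook_dist M n \<tau> k =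
     (INF \<alpha>\<in>{\<alpha> :: nat \<times> nat \<Rightarrow> real. finite {p \<in> hook_indices n k. \<alpha> p \<noteq> 0}}.
        integral\<^sup>L M (\<lambda>\<omega>. (\<tau> k k \<omega> -
          (\<Sum>(i, j)\<in>{p \<in> hook_indices n k. \<alpha> p \<noteq> 0}. \<alpha> (i, j) * \<tau> i j \<omega>))\<^sup>2))"

end

theory Submission
  imports Defs "Jordan_Normal_Form.Schur_Decomposition" "HOL-Real_Asymp.Real_Asymp"
begin

text \<open>
  Write \<open>A\<^sub>m\<close> for the leading \<open>m \<times> m\<close> block of \<open>A\<close>. Splitting off the first \<open>n\<close> columns gives
  \<open>A A\<^sup>T = A\<^sub>n A\<^sub>n\<^sup>T + S\<close> with \<open>S\<close> positive semidefinite, so \<open>det A A\<^sup>T \<ge> (det A\<^sub>n)\<^sup>2\<close> almost surely and it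
  suffices to bound the small ball probability of \<open>det A\<^sub>n\<close>. Regressing the corner entry of \<open>A\<^sub>m\<close> on
  the other entries turns \<open>det A\<^sub>m\<close> into \<open>(\<surd>D r + L) det A\<^sub>m\<^sub>-\<^sub>1 + b\<close>, where \<open>r\<close> is standard normal and
  independent of \<open>L\<close>, \<open>b\<close>, \<open>A\<^sub>m\<^sub>-\<^sub>1\<close>, and \<open>D \<ge> d\<^sub>m\<close>. A centered interval has the largest normal
  probability among its translates, so the shift may be dropped, and induction on \<open>m\<close> yields the
  inequality, in fact for every \<open>\<epsilon> > 0\<close>.

  For the asymptotics, conditioning on one factor gives a recursion for the distribution function
  of the product. After \<open>t = exp (-u)\<close> it is a convolution on the line whose kernel converges to a
  constant on one side and to \<open>0\<close> on the other, so that every step integrates \<open>u\<^sup>m\<close> once.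
\<close>

text \<open>Joint Gaussianity is given only through the laws of linear combinations, so independence
  of a regression residual has to come from characteristic functions in several variables. It is
  phrased as an equality of laws: the block of entries is replaced by a model on the product of the
  standard normal law with \<open>M\<close>, where independence is built in.

  The corner is the only entry of the \<open>m\<close> by \<open>m\<close> block with
  \<open>min i j = m\<close>. All other entries of the block are hook indices, so the residual
  variance \<open>D\<close> is one of the values over which the infimum defining the hook distance
  is taken; hence the lower bound on \<open>D\<close>.

  Once the shift is dropped, the order of integration is exchanged. For fixed \<open>r\<close> the
  event bounds the minor of order \<open>m - 1\<close> by
  \<open>e / (sqrt D * \<bar>r\<bar>)\<close>, and integrating the induction hypothesis over
  \<open>r\<close> is exactly the recursion for the distribution function of the product.

  In the asymptotics every factor contributes \<open>2 / sqrt (2 * pi)\<close>, twice the normal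
  density at 0, and integrating a power contributes \<open>1 / (m + 1)\<close>; these fractions
  build up the factorial.\<close>

section \<open>Finite-dimensional uniqueness of characteristic functions\<close>

text \<open>Frequency 0 shows that both weights have the same total mass. If it is zero, both sides
  vanish; otherwise dividing by it gives probability measures and the usual uniqueness theorem
  applies. The weights are there to carry the other coordinates in the multivariate
  induction.\<close>

lemma Levy_uniqueness_weighted:
  fixes w1 Y1 :: "'a \<Rightarrow> real" and w2 Y2 :: "'b \<Rightarrow> real"
  assumes w1: "integrable M1 w1" "\<And>x. 0 \<le> w1 x" and w2: "integrable M2 w2" "\<And>x. 0 \<le> w2 x"
    and Y [measurable]: "Y1 \<in> borel_measurable M1" "Y2 \<in> borel_measurable M2"
    and char_eq: "\<And>s. (CLINT x|M1. w1 x * iexp (s * Y1 x)) = (CLINT x|M2. w2 x * iexp (s * Y2 x))"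
    and B [measurable]: "B \<in> sets borel"
  shows "(LINT x|M1. w1 x * indicator B (Y1 x)) = (LINT x|M2. w2 x * indicator B (Y2 x))"
proof -
  have [measurable]: "w1 \<in> borel_measurable M1" "w2 \<in> borel_measurable M2"
    using w1 w2 by auto
  define c where "c = (LINT x|M1. w1 x)"
  have "complex_of_real c = complex_of_real (LINT x|M2. w2 x)"
    using char_eq[of 0] unfolding c_def by simp
  then have c2: "(LINT x|M2. w2 x) = c"
    unfolding of_real_eq_iff by simp
  have c_nonneg: "0 \<le> c"
    unfolding c_def using w1 by (intro Bochner_Integration.integral_nonneg) auto
  show ?thesis
  proof (cases "c = 0")
    case True
    have "AE x in M1. w1 x = 0"
      using True w1 integral_nonneg_eq_0_iff_AE[of M1 w1] unfolding c_def by auto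
    moreover have "AE x in M2. w2 x = 0"
      using True c2 w2 integral_nonneg_eq_0_iff_AE[of M2 w2] by auto
    ultimately have "(LINT x|M1. w1 x * indicator B (Y1 x)) = 0" "(LINT x|M2. w2 x * indicator B (Y2 x)) = 0"
      by (auto intro!: integral_eq_zero_AE)
    then show ?thesis by simp
  next
    case False
    then have c: "0 < c" using c_nonneg by simp
    have *: "real_distribution (distr (density M (\<lambda>x. ennreal (w x / c))) borel Y) \<and>
       (\<forall>s. char (distr (density M (\<lambda>x. ennreal (w x / c))) borel Y) s = (CLINT x|M. w x * iexp (s * Y x)) / c) \<and>
       measure (distr (density M (\<lambda>x. ennreal (w x / c))) borel Y) B = (LINT x|M. w x * indicator B (Y x)) / c"
      if w: "integrable M w" "\<And>x. 0 \<le> w x" "(LINT x|M. w x) = c" and [measurable]: "Y \<in> borel_measurable M"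
      for M :: "'c measure" and w Y :: "'c \<Rightarrow> real"
    proof -
      have [measurable]: "w \<in> borel_measurable M" using w by auto
      let ?D = "density M (\<lambda>x. ennreal (w x / c))"
      have nonneg: "0 \<le> w x / c" for x using w c by auto
      have "emeasure ?D (space ?D) = (\<integral>\<^sup>+x. ennreal (w x / c) \<partial>M)"
        by (simp add: emeasure_density cong: nn_integral_cong)
      also have "\<dots> = ennreal (LINT x|M. w x / c)"
        using w nonneg by (intro nn_integral_eq_integral) auto
      also have "\<dots> = 1" using w c by simp
      finally interpret D: prob_space ?D by (intro prob_spaceI)
      have 1: "real_distribution (distr ?D borel Y)"
        by (intro D.real_distribution_distr) simp
      have 2: "char (distr ?D borel Y) s = (CLINT x|M. w x * iexp (s * Y x)) / c" for s
      proof -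
        have "char (distr ?D borel Y) s = (CLINT x|?D. iexp (s * Y x))"
          unfolding char_def by (subst integral_distr) auto
        also have "\<dots> = (CLINT x|M. (w x / c) *\<^sub>R iexp (s * Y x))"
          using nonneg by (subst integral_density) auto
        also have "\<dots> = (CLINT x|M. w x * iexp (s * Y x) / c)"
          by (intro Bochner_Integration.integral_cong) (auto simp: scaleR_conv_of_real)
        also have "\<dots> = (CLINT x|M. w x * iexp (s * Y x)) / c" by simp
        finally show ?thesis .
      qed
      interpret R: real_distribution "distr ?D borel Y" by fact
      have "measure (distr ?D borel Y) B = (LINT x|distr ?D borel Y. indicator B x)"
        by simp
      also have "\<dots> = (LINT x|?D. indicator B (Y x))" by (subst integral_distr) auto
      also have "\<dots> = (LINT x|M. (w x / c) *\<^sub>R indicator B (Y x))"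
        using nonneg by (subst integral_density) auto
      also have "\<dots> = (LINT x|M. w x * indicator B (Y x) / c)"
        by (intro Bochner_Integration.integral_cong) auto
      also have "\<dots> = (LINT x|M. w x * indicator B (Y x)) / c" by simp
      finally show ?thesis using 1 2 by blast
    qed
    note 1 = *[OF w1 c_def[symmetric] Y(1)] and 2 = *[OF w2 c2 Y(2)]
    have "distr (density M1 (\<lambda>x. ennreal (w1 x / c))) borel Y1 = distr (density M2 (\<lambda>x. ennreal (w2 x / c))) borel Y2"
      using 1 2 char_eq by (intro Levy_uniqueness) auto
    with 1 2 have "(LINT x|M1. w1 x * indicator B (Y1 x)) / c = (LINT x|M2. w2 x * indicator B (Y2 x)) / c"
      by metis
    with c show ?thesis by simp
  qed
qed

lemma integrable_weighted_iexp:
  fixes w g :: "'a \<Rightarrow> real"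
  assumes "integrable M w" and [measurable]: "g \<in> borel_measurable M"
  shows "integrable M (\<lambda>x. w x * iexp (g x))"
proof -
  have [measurable]: "w \<in> borel_measurable M" using assms by auto
  show ?thesis
    by (rule Bochner_Integration.integrable_bound[OF assms(1)]) (auto simp: norm_mult)
qed

text \<open>By Euler's formulas, multiplying the weight by \<open>1 + cos \<theta>\<close> or
  \<open>1 + sin \<theta>\<close> only combines integrals at the phases \<open>g\<close>,
  \<open>g + \<theta>\<close> and \<open>g - \<theta>\<close>. In the application these are again
  values of the joint characteristic function.\<close>

lemma integral_weighted_cos_sin:
  fixes w g \<theta> :: "'a \<Rightarrow> real"
  assumes w: "integrable M w" and [measurable]: "g \<in> borel_measurable M" "\<theta> \<in> borel_measurable M"
  shows "(CLINT x|M. (w x * (1 + cos (\<theta> x))) * iexp (g x)) =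
      (CLINT x|M. w x * iexp (g x)) +
      ((CLINT x|M. w x * iexp (g x + \<theta> x)) + (CLINT x|M. w x * iexp (g x - \<theta> x))) / 2"
    and "(CLINT x|M. (w x * (1 + sin (\<theta> x))) * iexp (g x)) =
      (CLINT x|M. w x * iexp (g x)) +
      ((CLINT x|M. w x * iexp (g x + \<theta> x)) - (CLINT x|M. w x * iexp (g x - \<theta> x))) / (2 * \<i>)"
proof -
  have i: "integrable M (\<lambda>x. w x * iexp (g x))" "integrable M (\<lambda>x. w x * iexp (g x + \<theta> x))"
    "integrable M (\<lambda>x. w x * iexp (g x - \<theta> x))"
    by (intro integrable_weighted_iexp w, measurable)+
  have c: "(w x * (1 + cos (\<theta> x))) * iexp (g x) =
      w x * iexp (g x) + (w x * iexp (g x + \<theta> x) + w x * iexp (g x - \<theta> x)) / 2" for x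
    by (simp add: exp_add exp_diff distrib_left right_diff_distrib cos_of_real[symmetric] cos_exp_eq exp_minus field_simps)
  have s: "(w x * (1 + sin (\<theta> x))) * iexp (g x) =
      w x * iexp (g x) + (w x * iexp (g x + \<theta> x) - w x * iexp (g x - \<theta> x)) / (2 * \<i>)" for x
    by (simp add: exp_add exp_diff distrib_left right_diff_distrib sin_of_real[symmetric] sin_exp_eq exp_minus field_simps)
  show "(CLINT x|M. (w x * (1 + cos (\<theta> x))) * iexp (g x)) =
      (CLINT x|M. w x * iexp (g x)) +
      ((CLINT x|M. w x * iexp (g x + \<theta> x)) + (CLINT x|M. w x * iexp (g x - \<theta> x))) / 2"
    unfolding c using i by simp
  show "(CLINT x|M. (w x * (1 + sin (\<theta> x))) * iexp (g x)) =
      (CLINT x|M. w x * iexp (g x)) +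
      ((CLINT x|M. w x * iexp (g x + \<theta> x)) - (CLINT x|M. w x * iexp (g x - \<theta> x))) / (2 * \<i>)"
    unfolding s using i by simp
qed

text \<open>The coordinates are treated one at a time: for fixed frequencies of the remaining ones, with
  phase \<open>\<theta>\<close>, the factors \<open>1 + cos \<theta>\<close> and \<open>1 + sin \<theta>\<close> are nonnegative and can be absorbed into the
  weight, so that the one-dimensional statement applies.\<close>

lemma Levy_uniqueness_weighted_family:
  fixes w1 :: "'a \<Rightarrow> real" and w2 :: "'b \<Rightarrow> real"
    and V1 :: "'i \<Rightarrow> 'a \<Rightarrow> real" and V2 :: "'i \<Rightarrow> 'b \<Rightarrow> real"
  assumes "finite I"
    and V1: "\<And>i. i \<in> I \<Longrightarrow> V1 i \<in> borel_measurable M1"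
    and V2: "\<And>i. i \<in> I \<Longrightarrow> V2 i \<in> borel_measurable M2"
    and B: "\<And>i. i \<in> I \<Longrightarrow> B i \<in> sets borel"
    and w1: "integrable M1 w1" "\<And>x. 0 \<le> w1 x" and w2: "integrable M2 w2" "\<And>x. 0 \<le> w2 x"
    and char_eq: "\<And>t. (CLINT x|M1. w1 x * iexp (\<Sum>i\<in>I. t i * V1 i x)) =
      (CLINT x|M2. w2 x * iexp (\<Sum>i\<in>I. t i * V2 i x))"
  shows "(LINT x|M1. w1 x * (\<Prod>i\<in>I. indicator (B i) (V1 i x))) =
    (LINT x|M2. w2 x * (\<Prod>i\<in>I. indicator (B i) (V2 i x)))"
  using assms
proof (induction I arbitrary: w1 w2 rule: finite_induct)
  case empty
  have "complex_of_real (LINT x|M1. w1 x) = complex_of_real (LINT x|M2. w2 x)"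
    using empty.prems(8) by simp
  then show ?case unfolding of_real_eq_iff by simp
next
  case (insert k I)
  note V [measurable] = insert.prems(1,2)
  have [measurable]: "V1 k \<in> borel_measurable M1" "V2 k \<in> borel_measurable M2" "B k \<in> sets borel"
    using insert.prems(1-3) by auto
  note w = insert.prems(4-7)
  have [measurable]: "w1 \<in> borel_measurable M1" "w2 \<in> borel_measurable M2"
    using w by auto
  \<comment> \<open>Coordinate \<open>k\<close> moves into the weights as an indicator. The
    induction hypothesis then requires that the characteristic functions of the remaining
    coordinates agree under the new weights.\<close>
  define u1 where "u1 x = w1 x * indicator (B k) (V1 k x)" for x
  define u2 where "u2 x = w2 x * indicator (B k) (V2 k x)" for x
  have u: "integrable M1 u1" "integrable M2 u2"
    unfolding u1_def u2_def
    by (rule Bochner_Integration.integrable_bound[OF w(1)], measurable, simp add: indicator_def)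
       (rule Bochner_Integration.integrable_bound[OF w(3)], measurable, simp add: indicator_def)
  have u_nonneg: "0 \<le> u1 x" "0 \<le> u2 y" for x y
    using w by (auto simp: u1_def u2_def)
  have "(CLINT x|M1. u1 x * iexp (\<Sum>i\<in>I. t i * V1 i x)) =
      (CLINT x|M2. u2 x * iexp (\<Sum>i\<in>I. t i * V2 i x))" for t
  proof -
    define \<theta>1 where "\<theta>1 x = (\<Sum>i\<in>I. t i * V1 i x)" for x
    define \<theta>2 where "\<theta>2 x = (\<Sum>i\<in>I. t i * V2 i x)" for x
    have \<theta> [measurable]: "\<theta>1 \<in> borel_measurable M1" "\<theta>2 \<in> borel_measurable M2"
      unfolding \<theta>1_def \<theta>2_def using V by (auto intro!: borel_measurable_sum borel_measurable_times)
    \<comment> \<open>The frequency is \<open>s\<close> on coordinate \<open>k\<close> and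
      \<open>r\<close> times the fixed vector \<open>t\<close> on the others; the values 0, 1 and -1
      of \<open>r\<close> give the three phases.\<close>
    have eq: "(CLINT x|M1. w1 x * iexp (s * V1 k x + r * \<theta>1 x)) =
      (CLINT x|M2. w2 x * iexp (s * V2 k x + r * \<theta>2 x))" for s r
    proof -
      have *: "(\<Sum>i\<in>insert k I. (if i = k then s else r * t i) * f i) = s * f k + r * (\<Sum>i\<in>I. t i * f i)"
        for f :: "'i \<Rightarrow> real"
        using insert.hyps by (auto simp: sum_distrib_left mult.assoc intro!: sum.cong)
      show ?thesis
        using insert.prems(8)[of "\<lambda>i. if i = k then s else r * t i"] unfolding * \<theta>1_def \<theta>2_def .
    qed
    have eq': "(CLINT x|M1. w1 x * iexp (s * V1 k x)) = (CLINT x|M2. w2 x * iexp (s * V2 k x))"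
       "(CLINT x|M1. w1 x * iexp (s * V1 k x + \<theta>1 x)) = (CLINT x|M2. w2 x * iexp (s * V2 k x + \<theta>2 x))"
       "(CLINT x|M1. w1 x * iexp (s * V1 k x - \<theta>1 x)) = (CLINT x|M2. w2 x * iexp (s * V2 k x - \<theta>2 x))" for s
      using eq[of s 0] eq[of s 1] eq[of s "-1"] by simp_all
    have bound: "0 \<le> 1 + cos a" "1 + cos a \<le> 2" "0 \<le> 1 + sin a" "1 + sin a \<le> 2" for a :: real
      using cos_ge_minus_one[of a] cos_le_one[of a] sin_ge_minus_one[of a] sin_le_one[of a] by linarith+
    have wt: "integrable M (\<lambda>x. w x * (1 + cos (\<theta> x)))" "integrable M (\<lambda>x. w x * (1 + sin (\<theta> x)))"
      if w: "integrable M w" "\<And>x. 0 \<le> w x" and [measurable]: "\<theta> \<in> borel_measurable M"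
      for M :: "'c measure" and w \<theta> :: "'c \<Rightarrow> real"
    proof -
      have [measurable]: "w \<in> borel_measurable M" using w by auto
      have i: "integrable M (\<lambda>x. 2 * w x)" using w by simp
      have le: "w x * (1 + cos (\<theta> x)) \<le> 2 * w x" "w x * (1 + sin (\<theta> x)) \<le> 2 * w x" for x
        using mult_left_mono[OF bound(2) w(2)] mult_left_mono[OF bound(4) w(2)] by (simp_all add: mult.commute)
      show "integrable M (\<lambda>x. w x * (1 + cos (\<theta> x)))" "integrable M (\<lambda>x. w x * (1 + sin (\<theta> x)))"
        by (rule Bochner_Integration.integrable_bound[OF i], measurable, simp add: abs_mult bound w le)+
    qed
    \<comment> \<open>Three integrals of \<open>u1\<close> are matched with those of
      \<open>u2\<close>: against 1, \<open>1 + cos\<close> and \<open>1 + sin\<close> of the phase.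
      Subtracting the first from the others leaves the real and imaginary parts of the required
      characteristic function.\<close>
    have base: "(LINT x|M1. u1 x) = (LINT x|M2. u2 x)"
      unfolding u1_def u2_def by (rule Levy_uniqueness_weighted) (use w eq' in auto)
    have cos: "(LINT x|M1. (w1 x * (1 + cos (\<theta>1 x))) * indicator (B k) (V1 k x)) =
        (LINT x|M2. (w2 x * (1 + cos (\<theta>2 x))) * indicator (B k) (V2 k x))"
    proof (rule Levy_uniqueness_weighted)
      fix s
      have m1: "(\<lambda>x. s * V1 k x) \<in> borel_measurable M1" and m2: "(\<lambda>x. s * V2 k x) \<in> borel_measurable M2"
        by measurable
      show "(CLINT x|M1. complex_of_real (w1 x * (1 + cos (\<theta>1 x))) * iexp (s * V1 k x)) =
        (CLINT x|M2. complex_of_real (w2 x * (1 + cos (\<theta>2 x))) * iexp (s * V2 k x))"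
        unfolding integral_weighted_cos_sin[OF w(1) m1 \<theta>(1)] integral_weighted_cos_sin[OF w(3) m2 \<theta>(2)] eq' ..
    qed (use w wt[OF w(1,2) \<theta>(1)] wt[OF w(3,4) \<theta>(2)] bound in auto)
    have sin: "(LINT x|M1. (w1 x * (1 + sin (\<theta>1 x))) * indicator (B k) (V1 k x)) =
        (LINT x|M2. (w2 x * (1 + sin (\<theta>2 x))) * indicator (B k) (V2 k x))"
    proof (rule Levy_uniqueness_weighted)
      fix s
      have m1: "(\<lambda>x. s * V1 k x) \<in> borel_measurable M1" and m2: "(\<lambda>x. s * V2 k x) \<in> borel_measurable M2"
        by measurable
      show "(CLINT x|M1. complex_of_real (w1 x * (1 + sin (\<theta>1 x))) * iexp (s * V1 k x)) =
        (CLINT x|M2. complex_of_real (w2 x * (1 + sin (\<theta>2 x))) * iexp (s * V2 k x))"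
        unfolding integral_weighted_cos_sin[OF w(1) m1 \<theta>(1)] integral_weighted_cos_sin[OF w(3) m2 \<theta>(2)] eq' ..
    qed (use w wt[OF w(1,2) \<theta>(1)] wt[OF w(3,4) \<theta>(2)] bound in auto)
    have split: "(LINT x|M. (w x * (1 + cos (\<theta> x))) * indicator C (V x)) =
          (LINT x|M. w x * indicator C (V x)) + (LINT x|M. (w x * indicator C (V x)) * cos (\<theta> x))"
        "(LINT x|M. (w x * (1 + sin (\<theta> x))) * indicator C (V x)) =
          (LINT x|M. w x * indicator C (V x)) + (LINT x|M. (w x * indicator C (V x)) * sin (\<theta> x))"
        "(CLINT x|M. (w x * indicator C (V x)) * iexp (\<theta> x)) =
          (LINT x|M. (w x * indicator C (V x)) * cos (\<theta> x)) + \<i> * (LINT x|M. (w x * indicator C (V x)) * sin (\<theta> x))"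
      if u: "integrable M (\<lambda>x. w x * indicator C (V x))" and [measurable]: "\<theta> \<in> borel_measurable M"
      for M :: "'c measure" and w \<theta> V :: "'c \<Rightarrow> real" and C
    proof -
      have [measurable]: "(\<lambda>x. w x * indicator C (V x)) \<in> borel_measurable M" using u by auto
      have i: "integrable M (\<lambda>x. (w x * indicator C (V x)) * cos (\<theta> x))"
         "integrable M (\<lambda>x. (w x * indicator C (V x)) * sin (\<theta> x))"
        by (rule Bochner_Integration.integrable_bound[OF u], measurable, simp add: abs_mult mult_le_one mult_left_le)+
      show "(LINT x|M. (w x * (1 + cos (\<theta> x))) * indicator C (V x)) =
          (LINT x|M. w x * indicator C (V x)) + (LINT x|M. (w x * indicator C (V x)) * cos (\<theta> x))"
        by (subst Bochner_Integration.integral_add[OF u i(1), symmetric])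
           (auto intro!: Bochner_Integration.integral_cong simp: algebra_simps)
      show "(LINT x|M. (w x * (1 + sin (\<theta> x))) * indicator C (V x)) =
          (LINT x|M. w x * indicator C (V x)) + (LINT x|M. (w x * indicator C (V x)) * sin (\<theta> x))"
        by (subst Bochner_Integration.integral_add[OF u i(2), symmetric])
           (auto intro!: Bochner_Integration.integral_cong simp: algebra_simps)
      have "(CLINT x|M. (w x * indicator C (V x)) * iexp (\<theta> x)) =
          (CLINT x|M. complex_of_real (w x * indicator C (V x) * cos (\<theta> x)) +
            \<i> * complex_of_real (w x * indicator C (V x) * sin (\<theta> x)))"
        by (intro Bochner_Integration.integral_cong) (auto simp: cis_conv_exp[symmetric] complex_eq_iff)
      also have "\<dots> = (CLINT x|M. complex_of_real (w x * indicator C (V x) * cos (\<theta> x))) +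
            \<i> * (CLINT x|M. complex_of_real (w x * indicator C (V x) * sin (\<theta> x)))"
        using i by (subst Bochner_Integration.integral_add) (auto simp del: of_real_mult)
      finally show "(CLINT x|M. (w x * indicator C (V x)) * iexp (\<theta> x)) =
          (LINT x|M. (w x * indicator C (V x)) * cos (\<theta> x)) + \<i> * (LINT x|M. (w x * indicator C (V x)) * sin (\<theta> x))"
        by (simp del: of_real_mult)
    qed
    note s1 = split[OF u(1)[unfolded u1_def], of \<theta>1, folded u1_def]
      and s2 = split[OF u(2)[unfolded u2_def], of \<theta>2, folded u2_def]
    show ?thesis
      unfolding \<theta>1_def[symmetric] \<theta>2_def[symmetric]
      using s1 s2 cos sin base by simp
  qed
  then have "(LINT x|M1. u1 x * (\<Prod>i\<in>I. indicator (B i) (V1 i x))) =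
    (LINT x|M2. u2 x * (\<Prod>i\<in>I. indicator (B i) (V2 i x)))"
    using insert.prems(1-3) u u_nonneg by (intro insert.IH) auto
  then show ?case
    using insert.hyps by (simp add: u1_def u2_def mult.assoc)
qed

text \<open>With weight 1 the weighted statement gives equal mass on all boxes, a generator of the
  product sigma-algebra closed under intersection. Equality of laws then transfers every measurable
  function of the coordinates, in particular a determinant.\<close>

theorem Levy_uniqueness_PiM:
  fixes V1 :: "'i \<Rightarrow> 'a \<Rightarrow> real" and V2 :: "'i \<Rightarrow> 'b \<Rightarrow> real"
  assumes I: "finite I" and M1: "prob_space M1" and M2: "prob_space M2"
    and V1: "\<And>i. i \<in> I \<Longrightarrow> V1 i \<in> borel_measurable M1"
    and V2: "\<And>i. i \<in> I \<Longrightarrow> V2 i \<in> borel_measurable M2"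
    and char_eq: "\<And>t. (CLINT x|M1. iexp (\<Sum>i\<in>I. t i * V1 i x)) = (CLINT x|M2. iexp (\<Sum>i\<in>I. t i * V2 i x))"
  shows "distr M1 (Pi\<^sub>M I (\<lambda>_. borel)) (\<lambda>x. \<lambda>i\<in>I. V1 i x) = distr M2 (Pi\<^sub>M I (\<lambda>_. borel)) (\<lambda>x. \<lambda>i\<in>I. V2 i x)"
proof -
  interpret M1: prob_space M1 by fact
  interpret M2: prob_space M2 by fact
  have V [measurable]: "(\<lambda>x. \<lambda>i\<in>I. V1 i x) \<in> measurable M1 (Pi\<^sub>M I (\<lambda>_. borel))"
    "(\<lambda>x. \<lambda>i\<in>I. V2 i x) \<in> measurable M2 (Pi\<^sub>M I (\<lambda>_. borel))"
    using V1 V2 by (auto intro: measurable_restrict)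
  have box: "emeasure (distr M (Pi\<^sub>M I (\<lambda>_. borel)) (\<lambda>x. \<lambda>i\<in>I. V i x)) (Pi\<^sub>E I B) =
      ennreal (LINT x|M. 1 * (\<Prod>i\<in>I. indicator (B i) (V i x)))"
    if M: "prob_space M" and B: "\<And>i. i \<in> I \<Longrightarrow> B i \<in> sets borel" and V: "\<And>i. i \<in> I \<Longrightarrow> V i \<in> borel_measurable M"
    for M :: "'c measure" and V B
  proof -
    interpret prob_space M by fact
    let ?S = "{x \<in> space M. \<forall>i\<in>I. V i x \<in> B i}"
    have [measurable]: "(\<lambda>x. \<lambda>i\<in>I. V i x) \<in> measurable M (Pi\<^sub>M I (\<lambda>_. borel))"
      using V by (auto intro: measurable_restrict)
    have P: "Pi\<^sub>E I B \<in> sets (Pi\<^sub>M I (\<lambda>_. borel))" using I B by (intro sets_PiM_I_finite) auto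
    have eq: "(\<lambda>x. \<lambda>i\<in>I. V i x) -` Pi\<^sub>E I B \<inter> space M = ?S" by (auto simp: PiE_iff)
    have S: "?S \<in> sets M" using measurable_sets[OF _ P, of "\<lambda>x. \<lambda>i\<in>I. V i x" M] eq by simp
    have "(LINT x|M. 1 * (\<Prod>i\<in>I. indicator (B i) (V i x))) = (LINT x|M. indicator ?S x :: real)"
      using I by (intro Bochner_Integration.integral_cong) (auto simp: indicator_def)
    also have "\<dots> = measure M ?S" using S by simp
    finally show ?thesis
      using P S eq by (simp add: emeasure_distr emeasure_eq_measure)
  qed
  show ?thesis
  proof (rule measure_eqI_PiM_finite[OF I, where A="\<lambda>_. space (Pi\<^sub>M I (\<lambda>_. borel))"])
    fix B :: "'i \<Rightarrow> real set" assume B: "\<And>i. i \<in> I \<Longrightarrow> B i \<in> sets borel"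
    have "(LINT x|M1. 1 * (\<Prod>i\<in>I. indicator (B i) (V1 i x) :: real)) = (LINT x|M2. 1 * (\<Prod>i\<in>I. indicator (B i) (V2 i x)))"
      using I B V1 V2 char_eq by (intro Levy_uniqueness_weighted_family) auto
    then show "emeasure (distr M1 (Pi\<^sub>M I (\<lambda>_. borel)) (\<lambda>x. \<lambda>i\<in>I. V1 i x)) (Pi\<^sub>E I B) =
        emeasure (distr M2 (Pi\<^sub>M I (\<lambda>_. borel)) (\<lambda>x. \<lambda>i\<in>I. V2 i x)) (Pi\<^sub>E I B)"
      using box[OF M1 B V1] box[OF M2 B V2] by simp
  next
    show "range (\<lambda>_. space (Pi\<^sub>M I (\<lambda>_. borel))) \<subseteq> prod_algebra I (\<lambda>_. borel :: real measure)"
      using I by (auto simp: space_PiM intro!: prod_algebraI_finite)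
    show "emeasure (distr M1 (Pi\<^sub>M I (\<lambda>_. borel)) (\<lambda>x. \<lambda>i\<in>I. V1 i x)) (space (Pi\<^sub>M I (\<lambda>_. borel))) \<noteq> \<infinity>"
      by (simp add: emeasure_distr M1.emeasure_finite)
  qed auto
qed

section \<open>Regression in a centered Gaussian family\<close>

definition square_integrable :: "'a measure \<Rightarrow> ('a \<Rightarrow> real) \<Rightarrow> bool" where
  "square_integrable M f \<longleftrightarrow> f \<in> borel_measurable M \<and> integrable M (\<lambda>x. (f x)\<^sup>2)"

lemma square_integrable_integrable_mult:
  assumes "square_integrable M f" "square_integrable M g"
  shows "integrable M (\<lambda>x. f x * g x)"
proof (rule Bochner_Integration.integrable_bound)
  show "integrable M (\<lambda>x. (f x)\<^sup>2 + (g x)\<^sup>2)"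
    using assms by (auto simp: square_integrable_def)
  show "(\<lambda>x. f x * g x) \<in> borel_measurable M"
    using assms by (auto simp: square_integrable_def)
  have "norm (f x * g x) \<le> norm ((f x)\<^sup>2 + (g x)\<^sup>2)" for x
  proof -
    have "2 * \<bar>f x * g x\<bar> \<le> (f x)\<^sup>2 + (g x)\<^sup>2"
      using sum_squares_bound[of "\<bar>f x\<bar>" "\<bar>g x\<bar>"] by (simp add: abs_mult)
    then show ?thesis by simp
  qed
  then show "AE x in M. norm (f x * g x) \<le> norm ((f x)\<^sup>2 + (g x)\<^sup>2)" by simp
qed

lemma square_integrable_add:
  assumes "square_integrable M f" "square_integrable M g"
  shows "square_integrable M (\<lambda>x. f x + g x)"
  unfolding square_integrable_def power2_sum
  using assms square_integrable_integrable_mult[OF assms]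
  by (auto simp: square_integrable_def mult.assoc)

lemma square_integrable_cmult:
  "square_integrable M f \<Longrightarrow> square_integrable M (\<lambda>x. c * f x)"
  by (auto simp: square_integrable_def power_mult_distrib)

lemma square_integrable_diff:
  "square_integrable M f \<Longrightarrow> square_integrable M g \<Longrightarrow> square_integrable M (\<lambda>x. f x - g x)"
  using square_integrable_add[of M f "\<lambda>x. -1 * g x"] square_integrable_cmult[of M g "-1"] by simp

lemma square_integrable_sum:
  "(\<And>i. i \<in> I \<Longrightarrow> square_integrable M (f i)) \<Longrightarrow> square_integrable M (\<lambda>x. \<Sum>i\<in>I. f i x)"
proof (induction I rule: infinite_finite_induct)
  case (insert i I)
  then show ?case by (auto intro: square_integrable_add)
qed (auto simp: square_integrable_def)

lemmas square_integrable_intros =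
  square_integrable_diff square_integrable_sum square_integrable_cmult

lemma integral_diff_mult_sum:
  assumes I: "finite I" "\<And>i. i \<in> I \<Longrightarrow> square_integrable M (V i)"
    and f: "square_integrable M f" "\<And>q. q \<in> I \<Longrightarrow> (LINT x|M. f x * V q x) = 0"
  shows "(LINT x|M. f x * (\<Sum>i\<in>I. c i * V i x)) = 0"
proof -
  have "(LINT x|M. f x * (\<Sum>i\<in>I. c i * V i x)) = (LINT x|M. (\<Sum>i\<in>I. c i * (f x * V i x)))"
    by (intro Bochner_Integration.integral_cong) (auto simp: sum_distrib_left mult_ac)
  also have "\<dots> = (\<Sum>i\<in>I. LINT x|M. c i * (f x * V i x))"
    using I f by (intro Bochner_Integration.integral_sum) (auto intro!: square_integrable_integrable_mult)
  also have "\<dots> = 0" using f by (intro sum.neutral) auto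
  finally show ?thesis .
qed

text \<open>One Gram-Schmidt step per index: the new function \<open>V k\<close> is reduced to its
  residual \<open>\<rho>\<close> over the old ones, and the residual \<open>\<eta>\<close> of
  \<open>Y\<close> is corrected by a multiple of \<open>\<rho>\<close>.\<close>

lemma L2_projection_exists:
  assumes "finite I" "\<And>i. i \<in> I \<Longrightarrow> square_integrable M (V i)" "square_integrable M Y"
  shows "\<exists>\<alpha>. \<forall>q\<in>I. (LINT x|M. (Y x - (\<Sum>i\<in>I. \<alpha> i * V i x)) * V q x) = 0"
  using assms
proof (induction I arbitrary: Y rule: finite_induct)
  case empty
  then show ?case by simp
next
  case (insert k I)
  note V = insert.prems(1)[OF insertI2] and Vk = insert.prems(1)[OF insertI1] and Y = insert.prems(2)
  obtain \<beta> where \<beta>: "\<And>q. q \<in> I \<Longrightarrow> (LINT x|M. (V k x - (\<Sum>i\<in>I. \<beta> i * V i x)) * V q x) = 0"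
    using insert.IH[OF V Vk] by blast
  obtain \<alpha> where \<alpha>: "\<And>q. q \<in> I \<Longrightarrow> (LINT x|M. (Y x - (\<Sum>i\<in>I. \<alpha> i * V i x)) * V q x) = 0"
    using insert.IH[OF V Y] by blast
  define \<rho> where "\<rho> x = V k x - (\<Sum>i\<in>I. \<beta> i * V i x)" for x
  define \<eta> where "\<eta> x = Y x - (\<Sum>i\<in>I. \<alpha> i * V i x)" for x
  have \<rho>: "square_integrable M \<rho>" unfolding \<rho>_def by (intro square_integrable_intros V Vk)
  have \<eta>: "square_integrable M \<eta>" unfolding \<eta>_def by (intro square_integrable_intros V Y)
  \<comment> \<open>If \<open>\<rho>\<close> vanishes almost everywhere, \<open>V k\<close> adds
    nothing to the span and any coefficient would do; \<open>\<eta>\<close> is then orthogonal to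
    \<open>\<rho>\<close> anyway.\<close>
  define \<gamma> where "\<gamma> = (if (LINT x|M. \<rho> x * \<rho> x) = 0 then 0 else (LINT x|M. \<eta> x * \<rho> x) / (LINT x|M. \<rho> x * \<rho> x))"
  have \<eta>\<rho>: "(LINT x|M. \<eta> x * \<rho> x) = 0" if "(LINT x|M. \<rho> x * \<rho> x) = 0"
  proof -
    have "AE x in M. \<rho> x * \<rho> x = 0"
      using that integral_nonneg_eq_0_iff_AE[OF square_integrable_integrable_mult[OF \<rho> \<rho>]] by auto
    then show ?thesis by (intro integral_eq_zero_AE) auto
  qed
  define \<alpha>' where "\<alpha>' i = (if i = k then \<gamma> else \<alpha> i - \<gamma> * \<beta> i)" for i
  have res: "Y x - (\<Sum>i\<in>insert k I. \<alpha>' i * V i x) = \<eta> x - \<gamma> * \<rho> x" for x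
  proof -
    have "(\<Sum>i\<in>I. \<alpha>' i * V i x) = (\<Sum>i\<in>I. \<alpha> i * V i x) - \<gamma> * (\<Sum>i\<in>I. \<beta> i * V i x)"
      using insert.hyps unfolding sum_distrib_left sum_subtractf[symmetric]
      by (intro sum.cong) (auto simp: \<alpha>'_def algebra_simps)
    then show ?thesis
      using insert.hyps by (simp add: \<alpha>'_def \<eta>_def \<rho>_def algebra_simps)
  qed
  define \<xi> where "\<xi> x = \<eta> x - \<gamma> * \<rho> x" for x
  have \<xi>: "square_integrable M \<xi>" unfolding \<xi>_def by (intro square_integrable_intros \<rho> \<eta>)
  have \<xi>_mult: "(LINT x|M. \<xi> x * g x) = (LINT x|M. \<eta> x * g x) - \<gamma> * (LINT x|M. \<rho> x * g x)"
    if g: "square_integrable M g" for g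
    unfolding \<xi>_def
    by (simp add: left_diff_distrib mult.assoc square_integrable_integrable_mult \<rho> \<eta> g)
  have \<xi>_I: "(LINT x|M. \<xi> x * V q x) = 0" if "q \<in> I" for q
    using \<alpha>[OF that] \<beta>[OF that] \<xi>_mult[OF V[OF that]] by (simp add: \<eta>_def \<rho>_def)
  \<comment> \<open>Since \<open>V k\<close> is \<open>\<rho>\<close> plus a combination of the old
    functions, orthogonality to \<open>V k\<close> reduces to orthogonality to \<open>\<rho>\<close>
    and to the old functions.\<close>
  have "(LINT x|M. \<xi> x * V k x) = (LINT x|M. \<xi> x * \<rho> x + \<xi> x * (\<Sum>i\<in>I. \<beta> i * V i x))"
    by (simp add: \<rho>_def algebra_simps)
  also have "\<dots> = (LINT x|M. \<xi> x * \<rho> x) + (LINT x|M. \<xi> x * (\<Sum>i\<in>I. \<beta> i * V i x))"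
    by (intro Bochner_Integration.integral_add square_integrable_integrable_mult \<xi> \<rho> square_integrable_intros V)
  also have "\<dots> = 0"
    using \<xi>_mult[OF \<rho>] \<eta>\<rho> integral_diff_mult_sum[OF insert.hyps(1) V \<xi> \<xi>_I]
    by (simp add: \<gamma>_def)
  finally have "\<forall>q\<in>insert k I. (LINT x|M. \<xi> x * V q x) = 0" using \<xi>_I by auto
  then show ?case unfolding \<xi>_def res[symmetric] by blast
qed

section \<open>Characteristic functions and regression of centered Gaussian families\<close>

lemma jointly_gaussian_subset: "jointly_gaussian M I Y \<Longrightarrow> J \<subseteq> I \<Longrightarrow> jointly_gaussian M J Y"
  unfolding jointly_gaussian_def by (meson order_trans)

lemma jointly_gaussian_component:
  assumes "jointly_gaussian M I Y" "i \<in> I"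
  shows "gaussian_rv M (Y i)"
proof -
  have "gaussian_rv M (\<lambda>\<omega>. \<Sum>i\<in>{i}. 1 * Y i \<omega>)"
    using assms(1)[unfolded jointly_gaussian_def, rule_format, of "{i}" "\<lambda>_. 1"] assms(2) by simp
  then show ?thesis by simp
qed

lemma jointly_gaussian_measurable:
  "jointly_gaussian M I Y \<Longrightarrow> i \<in> I \<Longrightarrow> Y i \<in> borel_measurable M"
  using jointly_gaussian_component[of M I Y i] by (simp add: gaussian_rv_def)

text \<open>Mean zero forces \<open>\<mu> = 0\<close> in both cases of \<open>gaussian_rv\<close>.
  The almost surely constant case obeys the same formula with second moment 0, so linear
  combinations can be treated without asking whether they degenerate.\<close>

lemma (in prob_space) gaussian_rv_centered:
  assumes "gaussian_rv M Y" and mean: "expectation Y = 0"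
  shows "square_integrable M Y"
    and "(CLINT x|M. iexp (t * Y x)) = exp (- (t\<^sup>2 * expectation (\<lambda>x. (Y x)\<^sup>2)) / 2)"
proof -
  have [measurable]: "Y \<in> borel_measurable M" using assms by (simp add: gaussian_rv_def)
  obtain \<mu> \<sigma> where "(0 < \<sigma> \<and> distributed M lborel Y (\<lambda>x. ennreal (normal_density \<mu> \<sigma> x))) \<or>
     (\<sigma> = 0 \<and> (AE x in M. Y x = \<mu>))"
    using assms unfolding gaussian_rv_def by blast
  then have "square_integrable M Y \<and>
      (CLINT x|M. iexp (t * Y x)) = exp (- (t\<^sup>2 * expectation (\<lambda>x. (Y x)\<^sup>2)) / 2)"
  proof (elim disjE conjE)
    assume \<sigma>: "0 < \<sigma>" and D: "distributed M lborel Y (\<lambda>x. ennreal (normal_density \<mu> \<sigma> x))"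
    have \<mu>: "\<mu> = 0" using normal_distributed_expectation[OF \<sigma> D] mean by simp
    have var: "expectation (\<lambda>x. (Y x)\<^sup>2) = \<sigma>\<^sup>2"
      using normal_distributed_variance[OF \<sigma> D] mean by simp
    have "integrable lborel (\<lambda>x. normal_density \<mu> \<sigma> x * x\<^sup>2)"
      using integrable_normal_moment[OF \<sigma>, of 0 2] \<mu> by simp
    then have "integrable M (\<lambda>x. (Y x)\<^sup>2)"
      using distributed_integrable[OF D, of "\<lambda>x. x\<^sup>2"] by simp
    then have 1: "square_integrable M Y" by (simp add: square_integrable_def)
    have D': "distributed M lborel (\<lambda>x. Y x / \<sigma>) (\<lambda>x. ennreal (std_normal_density x))"
      using D normal_standard_normal_convert[OF \<sigma>, of Y \<mu>] \<mu> by simp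
    have "(CLINT x|M. iexp (t * Y x)) = (CLINT x|M. iexp ((t * \<sigma>) * (Y x / \<sigma>)))"
      using \<sigma> by simp
    also have "\<dots> = (CLINT y|distr M lborel (\<lambda>x. Y x / \<sigma>). iexp ((t * \<sigma>) * y))"
      by (subst integral_distr) auto
    also have "\<dots> = char std_normal_distribution (t * \<sigma>)"
      unfolding char_def distributed_distr_eq_density[OF D'] ..
    also have "\<dots> = exp (- (t\<^sup>2 * expectation (\<lambda>x. (Y x)\<^sup>2)) / 2)"
      unfolding char_std_normal_distribution var by (simp add: power_mult_distrib)
    finally show ?thesis using 1 by simp
  next
    assume ae: "AE x in M. Y x = \<mu>"
    have "expectation Y = expectation (\<lambda>_. \<mu>)"
      using ae by (intro integral_cong_AE) auto
    then have "\<mu> = 0" using mean by (simp add: prob_space)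
    then have ae: "AE x in M. Y x = 0" using ae by simp
    have sq: "AE x in M. (Y x)\<^sup>2 = 0" using ae by eventually_elim simp
    have "integrable M (\<lambda>x. (Y x)\<^sup>2) \<longleftrightarrow> integrable M (\<lambda>_. 0 :: real)"
      using sq by (intro Bochner_Integration.integrable_cong_AE) auto
    then have 1: "square_integrable M Y" by (simp add: square_integrable_def)
    have "(CLINT x|M. iexp (t * Y x)) = (CLINT x|M. 1)"
    proof (intro integral_cong_AE)
      show "AE x in M. iexp (t * Y x) = 1" using ae by eventually_elim simp
    qed auto
    moreover have "expectation (\<lambda>x. (Y x)\<^sup>2) = 0" using sq by (intro integral_eq_zero_AE)
    ultimately show ?thesis using 1 by (simp add: prob_space)
  qed
  then show "square_integrable M Y"
    "(CLINT x|M. iexp (t * Y x)) = exp (- (t\<^sup>2 * expectation (\<lambda>x. (Y x)\<^sup>2)) / 2)" by auto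
qed

lemma prob_space_std_normal: "prob_space std_normal_distribution"
  by (rule prob_space_normal_density) simp

text \<open>The residual of the regression is uncorrelated with the other entries, so both families have
  the same characteristic functions.\<close>

lemma (in prob_space) gaussian_regression:
  fixes V :: "'i \<Rightarrow> 'a \<Rightarrow> real"
  assumes I: "finite I" "k \<notin> I"
    and gaussian: "jointly_gaussian M (insert k I) V"
    and centered: "\<And>i. i \<in> insert k I \<Longrightarrow> expectation (V i) = 0"
  obtains \<alpha> where
    "distr M (Pi\<^sub>M (insert k I) (\<lambda>_. borel)) (\<lambda>x. \<lambda>i\<in>insert k I. V i x) =
     distr (std_normal_distribution \<Otimes>\<^sub>M M) (Pi\<^sub>M (insert k I) (\<lambda>_. borel))
       (\<lambda>y. \<lambda>i\<in>insert k I. if i = k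
          then sqrt (expectation (\<lambda>x. (V k x - (\<Sum>i\<in>I. \<alpha> i * V i x))\<^sup>2)) * fst y + (\<Sum>i\<in>I. \<alpha> i * V i (snd y))
          else V i (snd y))"
proof -
  interpret S: prob_space std_normal_distribution by (rule prob_space_std_normal)
  interpret P: pair_prob_space std_normal_distribution M ..
  have lin: "gaussian_rv M (\<lambda>x. \<Sum>i\<in>J. c i * V i x)" if "J \<subseteq> insert k I" for J c
    using gaussian that I finite_subset[OF that] unfolding jointly_gaussian_def by blast
  note V_gauss = jointly_gaussian_component[OF gaussian]
  have V_sq: "square_integrable M (V i)" if "i \<in> insert k I" for i
    using gaussian_rv_centered(1)[OF V_gauss centered] that by blast
  have V_meas: "V i \<in> borel_measurable M" if "i \<in> insert k I" for i
    using V_sq[OF that] by (simp add: square_integrable_def)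
  have V_int: "integrable M (V i)" if "i \<in> insert k I" for i
    using square_integrable_integrable_mult[OF V_sq[OF that], of "\<lambda>_. 1"] by (simp add: square_integrable_def)
  have lin_mean: "expectation (\<lambda>x. \<Sum>i\<in>J. c i * V i x) = 0" if J: "J \<subseteq> insert k I" for J c
  proof -
    have "expectation (\<lambda>x. \<Sum>i\<in>J. c i * V i x) = (\<Sum>i\<in>J. expectation (\<lambda>x. c i * V i x))"
      using J V_int by (intro Bochner_Integration.integral_sum) auto
    also have "\<dots> = 0" using J centered by (intro sum.neutral) auto
    finally show ?thesis .
  qed
  obtain \<alpha> where \<alpha>: "\<And>q. q \<in> I \<Longrightarrow> (LINT x|M. (V k x - (\<Sum>i\<in>I. \<alpha> i * V i x)) * V q x) = 0"
    using L2_projection_exists[of I M V "V k"] I(1) V_sq by blast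
  define R where "R x = V k x - (\<Sum>i\<in>I. \<alpha> i * V i x)" for x
  define D where "D = expectation (\<lambda>x. (R x)\<^sup>2)"
  have D: "0 \<le> D" unfolding D_def by (intro Bochner_Integration.integral_nonneg) auto
  have R_sq: "square_integrable M R"
    unfolding R_def by (intro square_integrable_intros V_sq insertI1) auto
  \<comment> \<open>The model: a fresh normal coordinate \<open>fst y\<close>, scaled by
    \<open>sqrt D\<close>, takes the place of the residual \<open>R\<close>, while the predictor and
    the other entries are read off at \<open>snd y\<close>.\<close>
  define W where "W i y = (if i = k then sqrt D * fst y + (\<Sum>i\<in>I. \<alpha> i * V i (snd y)) else V i (snd y))"
    for i and y :: "real \<times> 'a"
  have [measurable]: "(\<lambda>x. \<Sum>i\<in>I. c i * V i x) \<in> borel_measurable M" for c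
    using V_meas by (intro borel_measurable_sum borel_measurable_times) auto
  have "distr M (Pi\<^sub>M (insert k I) (\<lambda>_. borel)) (\<lambda>x. \<lambda>i\<in>insert k I. V i x) =
     distr (std_normal_distribution \<Otimes>\<^sub>M M) (Pi\<^sub>M (insert k I) (\<lambda>_. borel)) (\<lambda>y. \<lambda>i\<in>insert k I. W i y)"
  proof (rule Levy_uniqueness_PiM)
    show "finite (insert k I)" using I by simp
    show "prob_space M" "prob_space (std_normal_distribution \<Otimes>\<^sub>M M)"
      by unfold_locales
    show "V i \<in> borel_measurable M" if "i \<in> insert k I" for i using V_meas[OF that] .
    have [measurable]: "fst \<in> borel_measurable (std_normal_distribution \<Otimes>\<^sub>M M)"
      using measurable_fst[of std_normal_distribution M] by (simp cong: measurable_cong_sets)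
    show "W i \<in> borel_measurable (std_normal_distribution \<Otimes>\<^sub>M M)" if "i \<in> insert k I" for i
    proof (cases "i = k")
      case True
      then show ?thesis unfolding W_def by simp
    next
      case False
      then have [measurable]: "V i \<in> borel_measurable M" using that V_meas by auto
      show ?thesis using False unfolding W_def by simp
    qed
    fix t :: "'i \<Rightarrow> real"
    \<comment> \<open>Writing \<open>V k\<close> as \<open>R\<close> plus its predictor raises the
      coefficient of \<open>V i\<close> by \<open>t k * \<alpha> i\<close>. The rest
      \<open>U\<close> is orthogonal to \<open>R\<close>, so the variances of \<open>t k * R\<close>
      and \<open>U\<close> add.\<close>
    define U where "U x = (\<Sum>i\<in>I. (t i + t k * \<alpha> i) * V i x)" for x
    have U_sq: "square_integrable M U" unfolding U_def by (intro square_integrable_intros V_sq) auto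
    have [measurable]: "U \<in> borel_measurable M" unfolding U_def by measurable
    have split: "(\<Sum>i\<in>insert k I. t i * V i x) = t k * R x + U x" for x
      using I unfolding U_def R_def by (simp add: algebra_simps sum.distrib sum_distrib_left)
    have orth: "(LINT x|M. R x * U x) = 0"
      unfolding U_def
      by (rule integral_diff_mult_sum[OF I(1) _ R_sq]) (use V_sq \<alpha> in \<open>auto simp: R_def\<close>)
    have "expectation (\<lambda>x. (t k * R x + U x)\<^sup>2) =
        expectation (\<lambda>x. (t k)\<^sup>2 * (R x)\<^sup>2 + (U x)\<^sup>2 + 2 * t k * (R x * U x))"
      by (intro Bochner_Integration.integral_cong) (auto simp: power2_sum power_mult_distrib)
    also have "\<dots> = (t k)\<^sup>2 * D + expectation (\<lambda>x. (U x)\<^sup>2)"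
      using R_sq U_sq square_integrable_integrable_mult[OF R_sq U_sq] orth
      by (simp add: D_def square_integrable_def)
    finally have var: "expectation (\<lambda>x. (t k * R x + U x)\<^sup>2) = (t k)\<^sup>2 * D + expectation (\<lambda>x. (U x)\<^sup>2)" .
    have "(CLINT x|M. iexp (\<Sum>i\<in>insert k I. t i * V i x)) =
        exp (- (expectation (\<lambda>x. (t k * R x + U x)\<^sup>2)) / 2)"
      using gaussian_rv_centered(2)[OF lin[OF subset_refl, of t] lin_mean[OF subset_refl, of t], of 1]
      unfolding split by simp
    \<comment> \<open>Additivity of the variances factors the exponential. The first factor is the
      characteristic function of a standard normal variable at \<open>t k * sqrt D\<close>, the
      second that of \<open>U\<close>; their product is an integral over the product space.\<close>
    also have "\<dots> = complex_of_real (exp (- ((t k * sqrt D)\<^sup>2) / 2)) * exp (- (expectation (\<lambda>x. (U x)\<^sup>2)) / 2)"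
      unfolding var of_real_mult[symmetric] exp_add[symmetric] using D
      by (simp add: power_mult_distrib exp_add[symmetric] diff_divide_distrib)
    also have "\<dots> = (CLINT r|std_normal_distribution. iexp ((t k * sqrt D) * r)) * (CLINT x|M. iexp (U x))"
      using gaussian_rv_centered(2)[OF lin[OF subset_insertI, of "\<lambda>i. t i + t k * \<alpha> i"] lin_mean[OF subset_insertI], of 1]
      unfolding char_std_normal_distribution[unfolded char_def, THEN fun_cong] U_def by (simp add: subset_insertI)
    also have "\<dots> = (CLINT r|std_normal_distribution. (CLINT x|M. iexp (t k * sqrt D * fst (r, x) + U (snd (r, x)))))"
      by (simp add: distrib_left exp_add)
    also have "\<dots> = (CLINT y|std_normal_distribution \<Otimes>\<^sub>M M. iexp (t k * sqrt D * fst y + U (snd y)))"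
    proof (rule P.integral_fst')
      show "integrable (std_normal_distribution \<Otimes>\<^sub>M M) (\<lambda>y. iexp (t k * sqrt D * fst y + U (snd y)))"
        using integrable_weighted_iexp[of "std_normal_distribution \<Otimes>\<^sub>M M" "\<lambda>_. 1" "\<lambda>y. t k * sqrt D * fst y + U (snd y)"]
        by simp
    qed
    also have "\<dots> = (CLINT y|std_normal_distribution \<Otimes>\<^sub>M M. iexp (\<Sum>i\<in>insert k I. t i * W i y))"
    proof -
      have "(\<Sum>i\<in>insert k I. t i * W i y) = t k * sqrt D * fst y + U (snd y)" for y
      proof -
        have "(\<Sum>i\<in>I. t i * W i y) = (\<Sum>i\<in>I. t i * V i (snd y))"
          using I by (intro sum.cong) (auto simp: W_def)
        then show ?thesis
          using I unfolding U_def by (simp add: W_def algebra_simps sum.distrib sum_distrib_left)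
      qed
      then show ?thesis by simp
    qed
    finally show "(CLINT x|M. iexp (\<Sum>i\<in>insert k I. t i * V i x)) =
        (CLINT y|std_normal_distribution \<Otimes>\<^sub>M M. iexp (\<Sum>i\<in>insert k I. t i * W i y))" .
  qed
  then show ?thesis
    unfolding W_def D_def R_def by (rule that)
qed

section \<open>Determinants\<close>

text \<open>Over the complex numbers the Schur form writes the determinant as the product of the
  eigenvalues. Splitting an eigenvector into real and imaginary parts, symmetry makes each
  eigenvalue real, and semidefiniteness of \<open>Q\<close> makes it at least 1.\<close>

lemma det_one_plus_psd_ge_1:
  fixes Q :: "real mat"
  assumes Q: "Q \<in> carrier_mat n n"
    and sym: "\<And>i j. i < n \<Longrightarrow> j < n \<Longrightarrow> Q $$ (i, j) = Q $$ (j, i)"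
    and psd: "\<And>x. 0 \<le> (\<Sum>i<n. \<Sum>j<n. x i * x j * Q $$ (i, j))"
  shows "1 \<le> Determinant.det (1\<^sub>m n + Q)"
proof -
  define M where "M = 1\<^sub>m n + Q"
  have M: "M \<in> carrier_mat n n" using Q by (simp add: M_def)
  define Mc where "Mc = map_mat complex_of_real M"
  have Mc: "Mc \<in> carrier_mat n n" using M by (simp add: Mc_def)
  have M_entry: "M $$ (i, j) = (if i = j then 1 else 0) + Q $$ (i, j)" if "i < n" "j < n" for i j
    using that Q by (auto simp: M_def)
  obtain as where as: "char_poly Mc = (\<Prod>a\<leftarrow>as. [:- a, 1:])"
    using char_poly_factorized[OF Mc] by auto
  obtain B P P' where "schur_decomposition Mc as = (B, P, P')" by (cases "schur_decomposition Mc as") auto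
  from schur_decomposition[OF Mc as this]
  have sim: "similar_mat_wit Mc B P P'" and ut: "upper_triangular B" and diag: "diag_mat B = as" by auto
  have "B \<in> carrier_mat n n" using sim Mc unfolding similar_mat_wit_def by (auto simp: Let_def)
  then have det: "Determinant.det Mc = prod_list as"
    using det_similar[of Mc B] sim ut diag det_upper_triangular unfolding similar_mat_def by metis
  have eig: "Im a = 0 \<and> 1 \<le> Re a" if "a \<in> set as" for a
  proof -
    have "poly (char_poly Mc) a = 0"
      using that unfolding as by (auto simp: poly_prod_list prod_list_zero_iff)
    then have "eigenvalue Mc a" using eigenvalue_root_char_poly[OF Mc] by simp
    then obtain v where v: "v \<in> carrier_vec n" "v \<noteq> 0\<^sub>v n" "Mc *\<^sub>v v = a \<cdot>\<^sub>v v"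
      using Mc unfolding eigenvalue_def eigenvector_def by auto
    define x where "x i = Re (vec_index v i)" for i
    define y where "y i = Im (vec_index v i)" for i
    define N where "N = (\<Sum>i<n. (x i)\<^sup>2 + (y i)\<^sup>2)"
    obtain i0 where i0: "i0 < n" "vec_index v i0 \<noteq> 0"
      using v by (metis carrier_vecD eq_vecI index_zero_vec(1) index_zero_vec(2))
    have "0 < (x i0)\<^sup>2 + (y i0)\<^sup>2"
      using i0 by (auto simp: x_def y_def complex_eq_iff sum_power2_gt_zero_iff)
    then have N_pos: "0 < N"
      unfolding N_def using i0 by (intro sum_pos2[where i=i0]) auto
    have row: "(\<Sum>j<n. complex_of_real (M $$ (i, j)) * vec_index v j) = a * vec_index v i" if i: "i < n" for i
    proof -
      have "vec_index (Mc *\<^sub>v v) i = (\<Sum>j<n. complex_of_real (M $$ (i, j)) * vec_index v j)"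
        using i v(1) M by (auto simp: Mc_def scalar_prod_def lessThan_atLeast0 intro!: sum.cong)
      then show ?thesis using v i by simp
    qed
    have re: "(\<Sum>j<n. M $$ (i, j) * x j) = Re a * x i - Im a * y i"
      and im: "(\<Sum>j<n. M $$ (i, j) * y j) = Re a * y i + Im a * x i" if i: "i < n" for i
      using arg_cong[OF row[OF i], of Re] arg_cong[OF row[OF i], of Im] by (simp_all add: x_def y_def)
    \<comment> \<open>By symmetry the bilinear form of \<open>M\<close> agrees on
      \<open>(y, x)\<close> and \<open>(x, y)\<close>. Inserting the eigenvalue equations, the
      difference of the two values is \<open>Im a * N\<close>.\<close>
    have swap: "(\<Sum>i<n. y i * (\<Sum>j<n. M $$ (i, j) * x j)) = (\<Sum>i<n. x i * (\<Sum>j<n. M $$ (i, j) * y j))"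
      unfolding sum_distrib_left
      by (subst sum.swap) (auto simp: M_entry sym intro!: sum.cong)
    have "(\<Sum>i<n. x i * (Re a * y i + Im a * x i)) - (\<Sum>i<n. y i * (Re a * x i - Im a * y i)) = 0"
      using swap by (simp add: re im)
    also have "(\<Sum>i<n. x i * (Re a * y i + Im a * x i)) - (\<Sum>i<n. y i * (Re a * x i - Im a * y i)) = Im a * N"
      unfolding N_def sum_distrib_left sum_subtractf[symmetric]
      by (intro sum.cong) (auto simp: algebra_simps power2_eq_square)
    finally have "Im a = 0" using N_pos by simp
    have quad: "(\<Sum>i<n. z i * (\<Sum>j<n. M $$ (i, j) * z j)) =
        (\<Sum>i<n. (z i)\<^sup>2) + (\<Sum>i<n. \<Sum>j<n. z i * z j * Q $$ (i, j))" for z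
    proof -
      have "(\<Sum>j<n. M $$ (i, j) * z j) = z i + (\<Sum>j<n. Q $$ (i, j) * z j)" if "i < n" for i
        using that by (simp add: M_entry distrib_right sum.distrib if_distrib[of "\<lambda>u. u * _"] cong: if_cong)
      then show ?thesis
        by (simp add: distrib_left sum.distrib power2_eq_square sum_distrib_left mult_ac)
    qed
    \<comment> \<open>The sum of the quadratic form of \<open>M\<close> at \<open>x\<close> and at
      \<open>y\<close> isolates \<open>Re a\<close>; its identity part alone already contributes
      \<open>N\<close>.\<close>
    have "Re a * N = (\<Sum>i<n. x i * (Re a * x i - Im a * y i)) + (\<Sum>i<n. y i * (Re a * y i + Im a * x i))"
      unfolding N_def sum_distrib_left sum.distrib[symmetric]
      by (intro sum.cong) (auto simp: algebra_simps power2_eq_square)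
    also have "\<dots> = (\<Sum>i<n. x i * (\<Sum>j<n. M $$ (i, j) * x j)) + (\<Sum>i<n. y i * (\<Sum>j<n. M $$ (i, j) * y j))"
      by (simp add: re im)
    also have "\<dots> \<ge> N"
      using psd[of x] psd[of y] unfolding quad N_def by (simp add: sum.distrib)
    finally have "N \<le> Re a * N" .
    with N_pos \<open>Im a = 0\<close> show ?thesis by simp
  qed
  have "\<exists>r\<ge>1. prod_list as = complex_of_real r"
    using eig
  proof (induction as)
    case Nil
    then show ?case by (intro exI[of _ 1]) auto
  next
    case (Cons a as)
    then obtain r where r: "1 \<le> r" "prod_list as = complex_of_real r" by auto
    have "a = complex_of_real (Re a)" "1 \<le> Re a" using Cons.prems[of a] by (auto simp: complex_eq_iff)
    then show ?case
      using r mult_mono[of 1 "Re a" 1 r] by (intro exI[of _ "Re a * r"]) auto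
  qed
  moreover have "Determinant.det Mc = complex_of_real (Determinant.det M)"
    unfolding Mc_def by (rule of_real_hom.hom_det)
  ultimately show ?thesis using det unfolding M_def by auto
qed

text \<open>With \<open>B\<close> the inverse of \<open>A\<close>, the matrix is
  \<open>A * (1 + Q) * A^T\<close> for \<open>Q = B * S * B^T\<close>. This \<open>Q\<close> is
  congruent to \<open>S\<close>, hence again symmetric and positive semidefinite, and the middle
  factor has determinant at least 1.\<close>

lemma det_mult_transpose_plus_psd_ge:
  fixes A S :: "real mat"
  assumes A: "A \<in> carrier_mat n n" and S: "S \<in> carrier_mat n n"
    and sym: "\<And>i j. i < n \<Longrightarrow> j < n \<Longrightarrow> S $$ (i, j) = S $$ (j, i)"
    and psd: "\<And>x. 0 \<le> (\<Sum>i<n. \<Sum>j<n. x i * x j * S $$ (i, j))"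
    and nz: "Determinant.det A \<noteq> 0"
  shows "(Determinant.det A)\<^sup>2 \<le> Determinant.det (A * transpose_mat A + S)"
proof -
  obtain B where B: "B \<in> carrier_mat n n" "A * B = 1\<^sub>m n" "B * A = 1\<^sub>m n"
    using det_non_zero_imp_unit[OF A nz, of undefined] unfolding Units_def by (auto simp: ring_mat_def)
  define Q where "Q = B * S * transpose_mat B"
  have Q: "Q \<in> carrier_mat n n" using B S by (simp add: Q_def)
  have entry: "Q $$ (i, j) = (\<Sum>k<n. \<Sum>l<n. B $$ (i, k) * S $$ (k, l) * B $$ (j, l))"
    if "i < n" "j < n" for i j
    using that B S
    by (auto simp: Q_def scalar_prod_def lessThan_atLeast0 sum_distrib_left mult.assoc intro!: sum.cong)
  have 1: "1 \<le> Determinant.det (1\<^sub>m n + Q)"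
  proof (rule det_one_plus_psd_ge_1[OF Q])
    fix i j assume ij: "i < n" "j < n"
    have "Q $$ (j, i) = (\<Sum>l<n. \<Sum>k<n. B $$ (j, k) * S $$ (k, l) * B $$ (i, l))"
      unfolding entry[OF ij(2,1)] by (rule sum.swap)
    also have "\<dots> = Q $$ (i, j)"
      unfolding entry[OF ij] by (intro sum.cong refl) (auto simp: sym)
    finally show "Q $$ (i, j) = Q $$ (j, i)" ..
  next
    fix x :: "nat \<Rightarrow> real"
    \<comment> \<open>\<open>z\<close> is \<open>B^T\<close> applied to \<open>x\<close>, so the
      form of \<open>Q\<close> at \<open>x\<close> becomes the form of \<open>S\<close> at
      \<open>z\<close>.\<close>
    define z where "z k = (\<Sum>i<n. x i * B $$ (i, k))" for k
    have "(\<Sum>i<n. \<Sum>j<n. x i * x j * Q $$ (i, j)) =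
        (\<Sum>i<n. \<Sum>j<n. \<Sum>k<n. \<Sum>l<n. (x i * B $$ (i, k)) * (x j * B $$ (j, l)) * S $$ (k, l))"
      by (auto simp: entry sum_distrib_left mult_ac intro!: sum.cong)
    also have "\<dots> = (\<Sum>i<n. \<Sum>k<n. \<Sum>j<n. \<Sum>l<n. (x i * B $$ (i, k)) * (x j * B $$ (j, l)) * S $$ (k, l))"
      by (intro sum.cong refl sum.swap)
    also have "\<dots> = (\<Sum>k<n. \<Sum>i<n. \<Sum>j<n. \<Sum>l<n. (x i * B $$ (i, k)) * (x j * B $$ (j, l)) * S $$ (k, l))"
      by (rule sum.swap)
    also have "\<dots> = (\<Sum>k<n. \<Sum>i<n. \<Sum>l<n. \<Sum>j<n. (x i * B $$ (i, k)) * (x j * B $$ (j, l)) * S $$ (k, l))"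
      by (intro sum.cong refl sum.swap)
    also have "\<dots> = (\<Sum>k<n. \<Sum>l<n. \<Sum>i<n. \<Sum>j<n. (x i * B $$ (i, k)) * (x j * B $$ (j, l)) * S $$ (k, l))"
      by (intro sum.cong refl sum.swap)
    also have "\<dots> = (\<Sum>k<n. \<Sum>l<n. z k * z l * S $$ (k, l))"
      unfolding z_def sum_product by (simp add: sum_distrib_right)
    also have "\<dots> \<ge> 0" by (rule psd)
    finally show "0 \<le> (\<Sum>i<n. \<Sum>j<n. x i * x j * Q $$ (i, j))" .
  qed
  have At: "transpose_mat A \<in> carrier_mat n n" and Bt: "transpose_mat B \<in> carrier_mat n n" using A B by auto
  have BA: "transpose_mat B * transpose_mat A = 1\<^sub>m n"
    using transpose_mult[OF A B(1)] B(2) by simp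
  have "A * Q * transpose_mat A = (A * B) * S * (transpose_mat B * transpose_mat A)"
    unfolding Q_def using A B(1) S At Bt by (simp add: assoc_mult_mat[of _ n n _ n _ n])
  also have "\<dots> = S" using S B BA by simp
  finally have AQA: "A * Q * transpose_mat A = S" .
  have "A * (1\<^sub>m n + Q) * transpose_mat A = (A + A * Q) * transpose_mat A"
    using A Q by (simp add: mult_add_distrib_mat[of _ n n _ n])
  also have "\<dots> = A * transpose_mat A + A * Q * transpose_mat A"
    using A Q At by (simp add: add_mult_distrib_mat[of _ n n _ _ n])
  finally have "A * transpose_mat A + S = A * (1\<^sub>m n + Q) * transpose_mat A"
    unfolding AQA by simp
  then have "Determinant.det (A * transpose_mat A + S) = Determinant.det A * Determinant.det (1\<^sub>m n + Q) * Determinant.det A"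
    using A Q At by (simp add: det_mult[of _ n] det_transpose)
  also have "\<dots> = (Determinant.det A)\<^sup>2 * Determinant.det (1\<^sub>m n + Q)"
    by (simp add: power2_eq_square)
  also have "\<dots> \<ge> (Determinant.det A)\<^sup>2 * 1"
    using 1 by (intro mult_left_mono) auto
  finally show ?thesis by simp
qed

lemma summable_mult_of_square_summable:
  fixes f g :: "nat \<Rightarrow> real"
  assumes "summable (\<lambda>j. (f j)\<^sup>2)" "summable (\<lambda>j. (g j)\<^sup>2)"
  shows "summable (\<lambda>j. f j * g j)"
proof (rule summable_comparison_test')
  show "summable (\<lambda>j. (f j)\<^sup>2 + (g j)\<^sup>2)" using assms by (rule summable_add)
  fix j :: nat
  have "2 * \<bar>f j * g j\<bar> \<le> (f j)\<^sup>2 + (g j)\<^sup>2"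
    using sum_squares_bound[of "\<bar>f j\<bar>" "\<bar>g j\<bar>"] by (simp add: abs_mult)
  then show "norm (f j * g j) \<le> (f j)\<^sup>2 + (g j)\<^sup>2" by simp
qed

text \<open>Columns from index \<open>n\<close> on form the Gram matrix \<open>S\<close> of the
  tails of the rows. Exchanging the finite sums with the series shows its quadratic form to be a
  series of squares.\<close>

lemma det_gram_ge_det_square:
  fixes f :: "nat \<Rightarrow> nat \<Rightarrow> real"
  assumes summable: "\<And>i. i < n \<Longrightarrow> summable (\<lambda>j. (f i j)\<^sup>2)"
    and nz: "Determinant.det (Matrix.mat n n (\<lambda>(i, j). f i j)) \<noteq> 0"
  shows "(Determinant.det (Matrix.mat n n (\<lambda>(i, j). f i j)))\<^sup>2 \<le>
    Determinant.det (Matrix.mat n n (\<lambda>(i, l). \<Sum>j. f i j * f l j))"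
proof -
  let ?A = "Matrix.mat n n (\<lambda>(i, j). f i j)"
  define S where "S = Matrix.mat n n (\<lambda>(i, l). \<Sum>j. f i (j + n) * f l (j + n))"
  have sm: "summable (\<lambda>j. f i j * f l j)" if "i < n" "l < n" for i l
    using that by (intro summable_mult_of_square_summable summable)
  have sm': "summable (\<lambda>j. f i (j + n) * f l (j + n))" if "i < n" "l < n" for i l
    using sm[OF that] by (rule summable_ignore_initial_segment)
  have "?A * transpose_mat ?A + S = Matrix.mat n n (\<lambda>(i, l). \<Sum>j. f i j * f l j)"
    by (rule eq_matI)
      (auto simp: S_def scalar_prod_def suminf_split_initial_segment[OF sm, of _ _ n] lessThan_atLeast0)
  moreover have "(Determinant.det ?A)\<^sup>2 \<le> Determinant.det (?A * transpose_mat ?A + S)"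
  proof (rule det_mult_transpose_plus_psd_ge[OF _ _ _ _ nz])
    fix x :: "nat \<Rightarrow> real"
    have "(\<Sum>i<n. \<Sum>l<n. x i * x l * S $$ (i, l)) =
        (\<Sum>i<n. \<Sum>l<n. \<Sum>j. x i * x l * (f i (j + n) * f l (j + n)))"
      by (auto simp: S_def suminf_mult sm' intro!: sum.cong)
    also have "\<dots> = (\<Sum>i<n. \<Sum>j. \<Sum>l<n. x i * x l * (f i (j + n) * f l (j + n)))"
      by (intro sum.cong refl suminf_sum[symmetric] summable_mult sm') auto
    also have "\<dots> = (\<Sum>j. \<Sum>i<n. \<Sum>l<n. x i * x l * (f i (j + n) * f l (j + n)))"
      by (intro suminf_sum[symmetric] summable_sum summable_mult sm') auto
    also have "\<dots> = (\<Sum>j. (\<Sum>i<n. x i * f i (j + n)) * (\<Sum>l<n. x l * f l (j + n)))"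
      by (simp add: sum_product mult_ac)
    also have "\<dots> \<ge> 0"
    proof (rule suminf_nonneg)
      have "summable (\<lambda>j. \<Sum>i<n. \<Sum>l<n. x i * x l * (f i (j + n) * f l (j + n)))"
        by (intro summable_sum summable_mult sm') auto
      then show "summable (\<lambda>j. (\<Sum>i<n. x i * f i (j + n)) * (\<Sum>l<n. x l * f l (j + n)))"
        by (simp add: sum_product mult_ac)
    qed (rule zero_le_square)
    finally show "0 \<le> (\<Sum>i<n. \<Sum>l<n. x i * x l * S $$ (i, l))" .
  qed (auto simp: S_def mult.commute)
  ultimately show ?thesis by simp
qed

text \<open>The argument is a family indexed by pairs, so the minor is a function on the product
  space \<open>Pi\<^sub>M\<close> on which the laws of blocks are compared. The successors convert
  to the indexing from 1.\<close>

definition leading_minor :: "nat \<Rightarrow> (nat \<times> nat \<Rightarrow> real) \<Rightarrow> real" where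
  "leading_minor m f = Determinant.det (Matrix.mat m m (\<lambda>(i, j). f (Suc i, Suc j)))"

lemma leading_minor_cong:
  "(\<And>p. p \<in> {1..m} \<times> {1..m} \<Longrightarrow> f p = g p) \<Longrightarrow> leading_minor m f = leading_minor m g"
  unfolding leading_minor_def by (intro arg_cong[where f=Determinant.det] eq_matI) auto

text \<open>Laplace expansion along the last row. Every cofactor there omits that row and so does
  not see the corner entry, and the corner's own cofactor is the preceding minor. The minor is
  therefore affine in the corner.\<close>

lemma leading_minor_Suc:
  "leading_minor (Suc m) f =
     f (Suc m, Suc m) * leading_minor m f + leading_minor (Suc m) (f((Suc m, Suc m) := 0))"
proof -
  define A where "A f = Matrix.mat (Suc m) (Suc m) (\<lambda>(i, j). f (Suc i, Suc j) :: real)" for f :: "nat \<times> nat \<Rightarrow> real"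
  let ?g = "f((Suc m, Suc m) := 0)"
  have exp: "leading_minor (Suc m) h = (\<Sum>j<m. h (Suc m, Suc j) * cofactor (A h) m j) + h (Suc m, Suc m) * cofactor (A h) m m"
    for h
    using laplace_expansion_row[of "A h" "Suc m" m]
    unfolding leading_minor_def A_def[symmetric] by (simp add: A_def)
  have cof: "cofactor (A f) m j = cofactor (A ?g) m j" for j
    unfolding cofactor_def
    by (intro arg_cong2[where f="(*)"] arg_cong[where f=Determinant.det] refl eq_matI)
      (auto simp: mat_delete_def A_def insert_index_def)
  have "mat_delete (A f) m m = Matrix.mat m m (\<lambda>(i, j). f (Suc i, Suc j))"
    by (rule eq_matI) (auto simp: mat_delete_def A_def insert_index_def)
  then have "cofactor (A f) m m = leading_minor m f"
    by (simp add: cofactor_def leading_minor_def)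
  then show ?thesis
    unfolding exp[of f] exp[of ?g] by (simp add: cof)
qed

lemma borel_measurable_leading_minor:
  assumes "{1..m} \<times> {1..m} \<subseteq> J"
  shows "leading_minor m \<in> borel_measurable (Pi\<^sub>M J (\<lambda>_. borel))"
proof -
  have "leading_minor m = (\<lambda>f. \<Sum>p | p permutes {0..<m}. signof p * (\<Prod>i=0..<m. f (Suc i, Suc (p i))))"
    by (intro ext) (auto simp: leading_minor_def det_def permutes_in_image intro!: sum.cong prod.cong)
  moreover have "(\<lambda>f. f (Suc i, Suc (p i))) \<in> borel_measurable (Pi\<^sub>M J (\<lambda>_. borel))"
    if "p permutes {0..<m}" "i \<in> {0..<m}" for p i
  proof (rule measurable_component_singleton)
    have "p i \<in> {0..<m}" using that permutes_in_image[OF that(1)] by blast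
    then have "Suc (p i) \<le> m" unfolding atLeastLessThan_iff by (intro Suc_leI) (rule conjunct2)
    moreover have "Suc i \<le> m" using that by auto
    ultimately have "(Suc i, Suc (p i)) \<in> {1..m} \<times> {1..m}" by simp
    then show "(Suc i, Suc (p i)) \<in> J" using assms by blast
  qed
  ultimately show ?thesis
    by (auto intro!: borel_measurable_sum borel_measurable_times borel_measurable_prod)
qed

lemma borel_measurable_leading_minor_family:
  assumes "\<And>p. p \<in> {1..m} \<times> {1..m} \<Longrightarrow> \<tau> p \<in> borel_measurable M"
  shows "(\<lambda>x. leading_minor m (\<lambda>p. \<tau> p x)) \<in> borel_measurable M"
proof -
  let ?J = "{1..m} \<times> {1..m}"
  have "(\<lambda>x. \<lambda>p\<in>?J. \<tau> p x) \<in> measurable M (Pi\<^sub>M ?J (\<lambda>_. borel))"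
    using assms by (intro measurable_restrict)
  from measurable_compose[OF this borel_measurable_leading_minor[OF order_refl]]
  have "(\<lambda>x. leading_minor m (\<lambda>p\<in>?J. \<tau> p x)) \<in> borel_measurable M" .
  moreover have "leading_minor m (\<lambda>p\<in>?J. \<tau> p x) = leading_minor m (\<lambda>p. \<tau> p x)" for x
    by (rule leading_minor_cong) simp
  ultimately show ?thesis by simp
qed

section \<open>The product of absolute values of normal variables\<close>

text \<open>Both iterated forms are kept because the small ball estimate passes from one to the
  other. The integrability claims serve the monotonicity of the outer integrals.\<close>

lemma (in pair_prob_space) measure_pair_eq_integral:
  assumes S: "S \<in> sets (M1 \<Otimes>\<^sub>M M2)"
  shows "measure (M1 \<Otimes>\<^sub>M M2) S = (LINT x|M1. measure M2 (Pair x -` S))"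
    and "measure (M1 \<Otimes>\<^sub>M M2) S = (LINT y|M2. measure M1 ((\<lambda>x. (x, y)) -` S))"
    and "integrable M1 (\<lambda>x. measure M2 (Pair x -` S))"
    and "integrable M2 (\<lambda>y. measure M1 ((\<lambda>x. (x, y)) -` S))"
proof -
  have m1: "(\<lambda>x. measure M2 (Pair x -` S)) \<in> borel_measurable M1"
    unfolding measure_def by (intro borel_measurable_enn2real M2.measurable_emeasure_Pair S)
  have e1: "(\<integral>\<^sup>+x. measure M2 (Pair x -` S) \<partial>M1) = emeasure (M1 \<Otimes>\<^sub>M M2) S"
    using M2.emeasure_pair_measure_alt[OF S] by (simp add: M2.emeasure_eq_measure)
  have "(LINT x|M1. measure M2 (Pair x -` S)) = enn2real (\<integral>\<^sup>+x. measure M2 (Pair x -` S) \<partial>M1)"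
    by (rule integral_eq_nn_integral[OF m1]) simp
  then show "measure (M1 \<Otimes>\<^sub>M M2) S = (LINT x|M1. measure M2 (Pair x -` S))"
    unfolding e1 by (simp only: measure_def)
  have m2: "(\<lambda>y. measure M1 ((\<lambda>x. (x, y)) -` S)) \<in> borel_measurable M2"
    unfolding measure_def by (intro borel_measurable_enn2real measurable_emeasure_Pair2 S)
  have e2: "(\<integral>\<^sup>+y. measure M1 ((\<lambda>x. (x, y)) -` S) \<partial>M2) = emeasure (M1 \<Otimes>\<^sub>M M2) S"
    using emeasure_pair_measure_alt2[OF S] by (simp add: M1.emeasure_eq_measure)
  have "(LINT y|M2. measure M1 ((\<lambda>x. (x, y)) -` S)) = enn2real (\<integral>\<^sup>+y. measure M1 ((\<lambda>x. (x, y)) -` S) \<partial>M2)"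
    by (rule integral_eq_nn_integral[OF m2]) simp
  then show "measure (M1 \<Otimes>\<^sub>M M2) S = (LINT y|M2. measure M1 ((\<lambda>x. (x, y)) -` S))"
    unfolding e2 by (simp only: measure_def)
  show "integrable M1 (\<lambda>x. measure M2 (Pair x -` S))"
    by (rule M1.integrable_const_bound[where B=1, OF _ m1]) simp
  show "integrable M2 (\<lambda>y. measure M1 ((\<lambda>x. (x, y)) -` S))"
    by (rule M2.integrable_const_bound[where B=1, OF _ m2]) simp
qed

section \<open>Normal probabilities of intervals\<close>

lemma std_normal_density_antimono: "\<bar>y\<bar> \<le> \<bar>x\<bar> \<Longrightarrow> std_normal_density x \<le> std_normal_density y"
  using abs_le_square_iff[of y x] by (simp add: std_normal_density_def divide_right_mono)

lemma measure_std_normal: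
  assumes "A \<in> sets borel"
  shows "measure std_normal_distribution A = (LINT x|lborel. std_normal_density x * indicator A x)"
proof -
  have "measure std_normal_distribution A = (LINT x|std_normal_distribution. indicator A x)"
    using assms by simp
  also have "\<dots> = (LINT x|lborel. std_normal_density x *\<^sub>R indicator A x)"
    using assms by (subst integral_density) auto
  finally show ?thesis by simp
qed

lemma integrable_std_normal_density_indicator:
  "A \<in> sets borel \<Longrightarrow> integrable lborel (\<lambda>x. std_normal_density x * indicator A x)"
  by (intro integrable_real_mult_indicator) auto

text \<open>On \<open>[-\<delta>, \<delta>]\<close> the density is at least its value at \<open>\<delta>\<close>, and off it at most that value, so
  the two factors below always have the same sign.\<close>

lemma measure_std_normal_centered_interval_max:
  assumes "0 \<le> \<delta>"
  shows "measure std_normal_distribution {u - \<delta>..u + \<delta>} \<le> measure std_normal_distribution {-\<delta>..\<delta>}"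
proof -
  let ?\<phi> = "std_normal_density" and ?I = "{-\<delta>..\<delta>}" and ?J = "{u - \<delta>..u + \<delta>}"
  \<comment> \<open>The two intervals have equal length, so the difference of their indicators
    integrates to zero against any constant, here the density at the endpoint
    \<open>\<delta>\<close>.\<close>
  have "0 = (LINT x|lborel. ?\<phi> \<delta> * (indicator ?I x - indicator ?J x))"
    using assms by simp
  also have "\<dots> \<le> (LINT x|lborel. ?\<phi> x * indicator ?I x - ?\<phi> x * indicator ?J x)"
  proof (intro integral_mono)
    fix x
    have "0 \<le> (?\<phi> x - ?\<phi> \<delta>) * (indicator ?I x - indicator ?J x)"
    proof (cases "x \<in> ?I")
      case True
      then have "?\<phi> \<delta> \<le> ?\<phi> x" by (intro std_normal_density_antimono) auto
      then show ?thesis using True by (auto simp: indicator_def)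
    next
      case False
      then have "?\<phi> x \<le> ?\<phi> \<delta>" using assms by (intro std_normal_density_antimono) auto
      then show ?thesis using False by (auto simp: indicator_def)
    qed
    then show "?\<phi> \<delta> * (indicator ?I x - indicator ?J x) \<le> ?\<phi> x * indicator ?I x - ?\<phi> x * indicator ?J x"
      by (simp add: algebra_simps)
  qed (use assms in \<open>auto intro!: integrable_std_normal_density_indicator\<close>)
  also have "\<dots> = (LINT x|lborel. ?\<phi> x * indicator ?I x) - (LINT x|lborel. ?\<phi> x * indicator ?J x)"
    by (intro Bochner_Integration.integral_diff integrable_std_normal_density_indicator) auto
  finally show ?thesis by (simp add: measure_std_normal)
qed

text \<open>For \<open>a \<noteq> 0\<close> and nonnegative \<open>e\<close>, division by
  \<open>a\<close> turns the events into an interval around \<open>- b / a\<close> and the centered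
  interval of the same length. The case \<open>a = 0\<close> arises when the smaller minor vanishes;
  then the right-hand event is the whole line. For negative \<open>e\<close> the left one is
  empty.\<close>

lemma measure_std_normal_affine_le:
  "measure std_normal_distribution {r. \<bar>a * r + b\<bar> \<le> e} \<le> measure std_normal_distribution {r. \<bar>a * r\<bar> \<le> e}"
proof -
  interpret S: prob_space std_normal_distribution by (rule prob_space_std_normal)
  consider "e < 0" | "0 \<le> e" "a = 0" | "0 \<le> e" "a \<noteq> 0" by linarith
  then show ?thesis
  proof cases
    case 1
    then have "{r. \<bar>a * r + b\<bar> \<le> e} = {}" by auto
    then show ?thesis by simp
  next
    case 2
    then have "{r. \<bar>a * r\<bar> \<le> e} = space std_normal_distribution" by auto
    then show ?thesis using S.prob_le_1 S.prob_space by simp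
  next
    case 3
    define \<delta> where "\<delta> = e / \<bar>a\<bar>"
    define u where "u = - b / a"
    have \<delta>: "0 \<le> \<delta>" using 3 by (simp add: \<delta>_def)
    have iff: "\<bar>a * r + c\<bar> \<le> e \<longleftrightarrow> \<bar>r + c / a\<bar> \<le> \<delta>" for r c
    proof -
      have "a * r + c = a * (r + c / a)" using 3 by (simp add: field_simps)
      then show ?thesis using 3 by (simp add: abs_mult \<delta>_def field_simps)
    qed
    have "{r. \<bar>a * r + b\<bar> \<le> e} = {u - \<delta>..u + \<delta>}"
      unfolding iff by (auto simp: u_def abs_le_iff)
    moreover have "{r. \<bar>a * r\<bar> \<le> e} = {-\<delta>..\<delta>}"
      unfolding iff[of _ 0, simplified] by (auto simp: abs_le_iff)
    ultimately show ?thesis using measure_std_normal_centered_interval_max[OF \<delta>] by simp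
  qed
qed

text \<open>The integrand is junk at \<open>x = 0\<close>, which is a null set.\<close>

primrec abs_normal_prod_cdf :: "nat \<Rightarrow> real \<Rightarrow> real" where
  "abs_normal_prod_cdf 0 t = (if 1 \<le> t then 1 else 0)"
| "abs_normal_prod_cdf (Suc m) t = (LINT x|std_normal_distribution. abs_normal_prod_cdf m (t / \<bar>x\<bar>))"

lemma abs_normal_prod_cdf_aux:
  "abs_normal_prod_cdf m \<in> borel_measurable borel \<and>
    (\<forall>t. 0 \<le> abs_normal_prod_cdf m t \<and> abs_normal_prod_cdf m t \<le> 1)"
proof (induction m)
  case 0
  then show ?case by auto
next
  case (Suc m)
  interpret S: prob_space std_normal_distribution by (rule prob_space_std_normal)
  have [measurable]: "abs_normal_prod_cdf m \<in> borel_measurable borel" using Suc by simp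
  have "(\<lambda>t. LINT x|std_normal_distribution. abs_normal_prod_cdf m (t / \<bar>x\<bar>)) \<in> borel_measurable borel"
    by measurable
  moreover have "(LINT x|std_normal_distribution. abs_normal_prod_cdf m (t / \<bar>x\<bar>)) \<le> 1" for t
    using Suc by (intro S.integral_le_const S.integrable_const_bound[where B=1]) auto
  ultimately show ?case
    using Suc by (auto intro!: Bochner_Integration.integral_nonneg simp: abs_normal_prod_cdf.simps(2)[abs_def])
qed

lemma borel_measurable_abs_normal_prod_cdf [measurable]: "abs_normal_prod_cdf m \<in> borel_measurable borel"
  and abs_normal_prod_cdf_nonneg [simp]: "0 \<le> abs_normal_prod_cdf m t"
  and abs_normal_prod_cdf_le_1 [simp]: "abs_normal_prod_cdf m t \<le> 1"
  using abs_normal_prod_cdf_aux by auto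

lemma integrable_abs_normal_prod_cdf:
  assumes [measurable]: "g \<in> borel_measurable borel"
  shows "integrable std_normal_distribution (\<lambda>x. abs_normal_prod_cdf m (g x))"
proof -
  interpret S: prob_space std_normal_distribution by (rule prob_space_std_normal)
  show ?thesis by (intro S.integrable_const_bound[where B=1]) auto
qed

lemma abs_normal_prod_cdf_mono: "s \<le> t \<Longrightarrow> abs_normal_prod_cdf m s \<le> abs_normal_prod_cdf m t"
proof (induction m arbitrary: s t)
  case (Suc m)
  show ?case
    unfolding abs_normal_prod_cdf.simps
    by (intro integral_mono integrable_abs_normal_prod_cdf Suc.IH divide_right_mono Suc.prems) auto
qed simp

lemma AE_std_normal_nonzero: "AE x in std_normal_distribution. x \<noteq> 0"
  by (auto simp: AE_density intro: AE_mp[OF AE_lborel_singleton[of 0]])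

text \<open>The recursion is conditioning on the last factor: for \<open>x \<noteq> 0\<close>, the
  condition that \<open>\<bar>x\<bar>\<close> times the product of the others is at most
  \<open>t\<close> bounds that product by \<open>t / \<bar>x\<bar>\<close>.\<close>

lemma (in prob_space) prob_prod_abs_normal:
  fixes X :: "nat \<Rightarrow> 'a \<Rightarrow> real"
  assumes indep: "indep_vars (\<lambda>_. borel) X {1..m}"
    and normal: "\<And>j. j \<in> {1..m} \<Longrightarrow> distributed M lborel (X j) (\<lambda>x. ennreal (std_normal_density x))"
  shows "prob {\<omega> \<in> space M. (\<Prod>j=1..m. \<bar>X j \<omega>\<bar>) \<le> t} = abs_normal_prod_cdf m t"
  using assms
proof (induction m arbitrary: t)
  case 0
  then show ?case using prob_space by simp
next
  case (Suc m)
  note IH = Suc.IH[OF indep_vars_subset[OF Suc.prems(1)] Suc.prems(2)]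
  define Z where "Z \<omega> = (\<Prod>j=1..m. \<bar>X j \<omega>\<bar>)" for \<omega>
  define Y where "Y = X (Suc m)"
  \<comment> \<open>Absolute values are taken in all factors but the last, which keeps its sign so
    that its law is exactly the standard normal one.\<close>
  have "indep_vars (\<lambda>_. borel) (\<lambda>j \<omega>. (if j = Suc m then X j \<omega> else \<bar>X j \<omega>\<bar>)) {1..Suc m}"
    by (rule indep_vars_compose2[OF Suc.prems(1), where Y="\<lambda>j x. if j = Suc m then x else \<bar>x\<bar>"]) auto
  moreover have "{1..Suc m} = insert (Suc m) {1..m}" by auto
  ultimately have "indep_var borel (\<lambda>\<omega>. (if Suc m = Suc m then X (Suc m) \<omega> else \<bar>X (Suc m) \<omega>\<bar>)) borel
      (\<lambda>\<omega>. \<Prod>j=1..m. (if j = Suc m then X j \<omega> else \<bar>X j \<omega>\<bar>))"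
    by (intro indep_vars_prod) auto
  also have "(\<lambda>\<omega>. \<Prod>j=1..m. (if j = Suc m then X j \<omega> else \<bar>X j \<omega>\<bar>)) = Z"
    unfolding Z_def by (intro ext prod.cong) auto
  finally have "indep_var borel Y borel Z" by (simp add: Y_def)
  then have [measurable]: "Y \<in> borel_measurable M" "Z \<in> borel_measurable M"
    and distr: "distr M borel Y \<Otimes>\<^sub>M distr M borel Z = distr M (borel \<Otimes>\<^sub>M borel) (\<lambda>\<omega>. (Y \<omega>, Z \<omega>))"
    unfolding indep_var_distribution_eq by auto
  have "distr M borel Y = distr M lborel Y" by (rule distr_cong) auto
  also have "\<dots> = std_normal_distribution"
    using Suc.prems(2)[of "Suc m"] unfolding Y_def by (simp add: distributed_distr_eq_density)
  finally have DY: "distr M borel Y = std_normal_distribution" .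
  interpret S: prob_space std_normal_distribution by (rule prob_space_std_normal)
  interpret Z: prob_space "distr M borel Z" by (rule prob_space_distr) simp
  interpret P: pair_prob_space std_normal_distribution "distr M borel Z" ..
  define S where "S = {y :: real \<times> real. \<bar>fst y\<bar> * snd y \<le> t}"
  have S: "S \<in> sets (borel \<Otimes>\<^sub>M borel)"
  proof -
    have "{y \<in> space (borel \<Otimes>\<^sub>M borel). \<bar>fst y\<bar> * snd y \<le> t} \<in> sets (borel \<Otimes>\<^sub>M borel :: (real \<times> real) measure)"
      by measurable
    then show ?thesis by (simp add: S_def space_pair_measure)
  qed
  have "prob {\<omega> \<in> space M. (\<Prod>j=1..Suc m. \<bar>X j \<omega>\<bar>) \<le> t} = measure (distr M (borel \<Otimes>\<^sub>M borel) (\<lambda>\<omega>. (Y \<omega>, Z \<omega>))) S"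
  proof -
    have "{\<omega> \<in> space M. (\<Prod>j=1..Suc m. \<bar>X j \<omega>\<bar>) \<le> t} = (\<lambda>\<omega>. (Y \<omega>, Z \<omega>)) -` S \<inter> space M"
      by (auto simp: S_def Y_def Z_def mult.commute)
    then show ?thesis using S by (subst measure_distr) auto
  qed
  also have "\<dots> = measure (std_normal_distribution \<Otimes>\<^sub>M distr M borel Z) S"
    by (simp add: distr[symmetric] DY)
  also have "\<dots> = (LINT x|std_normal_distribution. measure (distr M borel Z) (Pair x -` S))"
  proof (rule P.measure_pair_eq_integral(1))
    have "sets (std_normal_distribution \<Otimes>\<^sub>M distr M borel Z) = sets (borel \<Otimes>\<^sub>M borel :: (real \<times> real) measure)"
      by (intro sets_pair_measure_cong) auto
    then show "S \<in> sets (std_normal_distribution \<Otimes>\<^sub>M distr M borel Z)" using S by blast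
  qed
  also have "\<dots> = (LINT x|std_normal_distribution. abs_normal_prod_cdf m (t / \<bar>x\<bar>))"
  proof (rule integral_cong_AE)
    show "(\<lambda>x. measure (distr M borel Z) (Pair x -` S)) \<in> borel_measurable std_normal_distribution"
      unfolding measure_def
      by (intro borel_measurable_enn2real Z.measurable_emeasure_Pair) 
        (use S in \<open>simp cong: sets_pair_measure_cong\<close>)
    show "AE x in std_normal_distribution. measure (distr M borel Z) (Pair x -` S) = abs_normal_prod_cdf m (t / \<bar>x\<bar>)"
      using AE_std_normal_nonzero
    proof eventually_elim
      case (elim x)
      have "Pair x -` S = {z. z \<le> t / \<bar>x\<bar>}"
        using elim by (auto simp: S_def field_simps)
      then have "measure (distr M borel Z) (Pair x -` S) = prob {\<omega> \<in> space M. Z \<omega> \<le> t / \<bar>x\<bar>}"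
        by (subst measure_distr) (auto intro!: arg_cong[where f=prob])
      also have "\<dots> = abs_normal_prod_cdf m (t / \<bar>x\<bar>)"
        unfolding Z_def by (intro IH) auto
      finally show ?case .
    qed
  qed simp
  finally show ?case by simp
qed

section \<open>Asymptotics of the distribution function of the product\<close>

text \<open>The map \<open>exp (u * (s - 1))\<close> carries the line bijectively onto the positive
  half-line, and evenness gives the factor 2. With \<open>t = exp (- u)\<close> the shift by 1 makes
  \<open>t / x\<close> equal to \<open>exp (- (u * s))\<close>.\<close>

lemma std_normal_integral_exp_substitution:
  fixes h :: "real \<Rightarrow> real" and u :: real
  assumes u: "0 < u" and [measurable]: "h \<in> borel_measurable borel" and bound: "\<And>x. \<bar>h x\<bar> \<le> 1"
  shows "(LINT x|std_normal_distribution. h \<bar>x\<bar>) =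
    2 * (LINT s|lborel. u * exp (u * (s - 1)) * (std_normal_density (exp (u * (s - 1))) * h (exp (u * (s - 1)))))"
proof -
  define f where "f x = std_normal_density x * h x" for x
  have [measurable]: "f \<in> borel_measurable borel" unfolding f_def by measurable
  have f_int: "integrable lborel f"
    unfolding f_def by (rule Bochner_Integration.integrable_bound[where f=std_normal_density])
      (use bound in \<open>auto simp: abs_mult intro!: mult_left_le\<close>)
  have f_set: "set_integrable lborel S f" if "S \<in> sets borel" for S
    using f_int that by (intro integrable_mult_indicator[of S lborel f, folded set_integrable_def]) auto
  define g where "g s = exp (u * (s - 1))" for s
  have [measurable]: "g \<in> borel_measurable borel" unfolding g_def by measurable
  have g_deriv: "(g has_real_derivative u * g s) (at s)" for s
    unfolding g_def by (auto intro!: derivative_eq_intros)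
  have g_range: "range g = {0<..}"
  proof safe
    fix x :: real assume "0 < x"
    then have "x = g (ln x / u + 1)" using u by (simp add: g_def)
    then show "x \<in> range g" by blast
  qed (simp add: g_def)
  \<comment> \<open>The trivial equation brings the fact into the form "absolutely integrable with a
    given integral", the shape that the change of variables theorem rewrites.\<close>
  have "f absolutely_integrable_on {0<..} \<and> integral {0<..} f = integral {0<..} f"
    using f_set[of "{0<..}"] by (auto simp: set_integrable_def integrable_completion)
  then have *: "(\<lambda>s. \<bar>u * g s\<bar> * f (g s)) absolutely_integrable_on UNIV \<and>
      integral UNIV (\<lambda>s. \<bar>u * g s\<bar> * f (g s)) = integral {0<..} f"
    unfolding g_range[symmetric]
    by (subst has_absolute_integral_change_of_variables_1'[where f=f and g=g and g'="\<lambda>s. u * g s" and S=UNIV])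
      (use u g_deriv in \<open>auto simp: inj_on_def g_def\<close>)
  have abs: "\<bar>u * g s\<bar> = u * g s" for s using u by (simp add: g_def)
  have "integrable lborel (\<lambda>s. u * g s * f (g s))"
    using * by (simp add: abs set_integrable_def integrable_completion)
  then have "set_integrable lborel UNIV (\<lambda>s. u * g s * f (g s))" by (simp add: set_integrable_def)
  from set_borel_integral_eq_integral(2)[OF this]
  have 1: "(LINT s|lborel. u * g s * f (g s)) = integral {0<..} f"
    using * by (simp add: abs set_lebesgue_integral_def)
  have 2: "integral {0<..} f = (LINT x|lborel. indicator {0<..} x * f x)"
    using set_borel_integral_eq_integral(2)[OF f_set[of "{0<..}"]] by (simp add: set_lebesgue_integral_def)
  have 3: "(LINT x|lborel. indicator {0<..} x * f x) = (LINT x|lborel. indicator {0..} x * (std_normal_density x * h \<bar>x\<bar>))"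
  proof (rule integral_cong_AE)
    show "AE x in lborel. indicator {0<..} x * f x = indicator {0..} x * (std_normal_density x * h \<bar>x\<bar>)"
      using AE_lborel_singleton[of 0] by eventually_elim (auto simp: indicator_def f_def)
  qed auto
  have "has_bochner_integral lborel (\<lambda>x. indicator {0..} x *\<^sub>R (std_normal_density x * h \<bar>x\<bar>))
      (LINT x|lborel. indicator {0..} x * (std_normal_density x * h \<bar>x\<bar>))"
    unfolding has_bochner_integral_iff
  proof
    have "integrable lborel (\<lambda>x. indicator {0..} x *\<^sub>R (std_normal_density x * h \<bar>x\<bar>)) \<longleftrightarrow> integrable lborel (\<lambda>x. indicator {0..} x *\<^sub>R f x)"
      by (intro Bochner_Integration.integrable_cong) (auto simp: f_def indicator_def)
    then show "integrable lborel (\<lambda>x. indicator {0..} x *\<^sub>R (std_normal_density x * h \<bar>x\<bar>))"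
      using f_set[of "{0..}"] by (simp add: set_integrable_def)
  qed simp
  from has_bochner_integral_even_function[OF this]
  have "(LINT x|lborel. std_normal_density x * h \<bar>x\<bar>) = 2 * (LINT x|lborel. indicator {0..} x * (std_normal_density x * h \<bar>x\<bar>))"
    by (simp add: has_bochner_integral_iff std_normal_density_def)
  moreover have "(LINT x|std_normal_distribution. h \<bar>x\<bar>) = (LINT x|lborel. std_normal_density x * h \<bar>x\<bar>)"
    by (subst integral_density) auto
  ultimately show ?thesis
    using 1 2 3 unfolding f_def g_def by simp
qed

lemma std_normal_density_le_exp: "std_normal_density x \<le> exp (- x\<^sup>2 / 2)"
proof -
  have "1 \<le> sqrt (2 * pi)" using pi_gt3 by simp
  then show ?thesis unfolding std_normal_density_def by (simp add: divide_le_eq mult_le_cancel_left1)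
qed

lemma std_normal_density_le_1: "std_normal_density x \<le> 1"
  by (rule order_trans[OF std_normal_density_le_exp]) simp

lemma tendsto_std_normal_density:
  assumes "(f \<longlongrightarrow> a) F"
  shows "((\<lambda>x. std_normal_density (f x)) \<longlongrightarrow> std_normal_density a) F"
  unfolding std_normal_density_def by (intro tendsto_intros assms) auto

text \<open>Keeps a single term of the exponential series. It trades the polynomial growth in the
  dominated convergence argument for an exponential.\<close>

lemma power_div_fact_le_exp:
  fixes x :: real
  assumes "0 \<le> x"
  shows "x ^ m / fact m \<le> exp x"
proof -
  have "(\<Sum>n\<in>{m}. x ^ n /\<^sub>R fact n) \<le> (\<Sum>n. x ^ n /\<^sub>R fact n)"
    using assms summable_exp_generic[of x] by (intro sum_le_suminf) auto
  then show ?thesis by (simp add: exp_def divide_inverse mult.commute)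
qed

lemma integrable_exp_minus_abs: "integrable lborel (\<lambda>s :: real. exp (- \<bar>s\<bar> / 2))"
proof -
  have "((\<lambda>x::real. exp (- (1/2) * x)) has_integral exp (- (1/2) * 0) / (1/2)) {0..}"
    by (rule has_integral_exp_minus_to_infinity) simp
  then have "set_integrable lebesgue {0..} (\<lambda>x::real. exp (- (1/2) * x))"
    by (intro nonnegative_absolutely_integrable_1) (auto simp: integrable_on_def)
  then have "integrable lborel (\<lambda>x::real. indicator {0..} x *\<^sub>R exp (- (1/2) * x))"
    by (simp add: set_integrable_def integrable_completion)
  moreover have "integrable lborel (\<lambda>x::real. indicator {0..} x *\<^sub>R exp (- (1/2) * x)) \<longleftrightarrow>
     integrable lborel (\<lambda>x::real. indicator {0..} x *\<^sub>R exp (- \<bar>x\<bar> / 2))"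
    by (intro Bochner_Integration.integrable_cong) (auto simp: indicator_def)
  ultimately have "has_bochner_integral lborel (\<lambda>x::real. indicator {0..} x *\<^sub>R exp (- \<bar>x\<bar> / 2))
     (LINT x|lborel. indicator {0..} x *\<^sub>R exp (- \<bar>x\<bar> / 2))"
    by (simp add: has_bochner_integral_iff)
  from has_bochner_integral_even_function[OF this] show ?thesis
    by (simp add: has_bochner_integral_iff)
qed

text \<open>With \<open>t = exp (- u)\<close> this is the normal probability of
  \<open>{-t..t}\<close>, squeezed between the length \<open>2 * t\<close> times the density at
  \<open>t\<close> and at 0.\<close>

lemma abs_normal_prod_cdf_1_asymp:
  "((\<lambda>u. abs_normal_prod_cdf 1 (exp (- u)) * exp u) \<longlongrightarrow> 2 / sqrt (2 * pi)) at_top"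
proof -
  have cdf: "abs_normal_prod_cdf 1 t = (LINT x|lborel. std_normal_density x * indicator {-t..t} x)" if t: "0 < t" for t
  proof -
    have "abs_normal_prod_cdf 1 t = (LINT x|std_normal_distribution. (if 1 \<le> t / \<bar>x\<bar> then 1 else 0))"
      by simp
    also have "\<dots> = (LINT x|std_normal_distribution. indicator {-t..t} x)"
    proof (rule integral_cong_AE)
      show "AE x in std_normal_distribution. (if 1 \<le> t / \<bar>x\<bar> then 1 else 0) = (indicator {-t..t} x :: real)"
        using AE_std_normal_nonzero by eventually_elim (auto simp: indicator_def field_simps)
    qed auto
    also have "\<dots> = (LINT x|lborel. std_normal_density x * indicator {-t..t} x)"
      using measure_std_normal[of "{-t..t}"] by simp
    finally show ?thesis .
  qed
  have low: "2 * std_normal_density (exp (- u)) \<le> abs_normal_prod_cdf 1 (exp (- u)) * exp u"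
    and up: "abs_normal_prod_cdf 1 (exp (- u)) * exp u \<le> 2 * std_normal_density 0" for u
  proof -
    define t where "t = exp (- u)"
    have t: "0 < t" by (simp add: t_def)
    have int: "(LINT x|lborel. c * indicator {-t..t} x) = 2 * t * c"
      and int': "integrable lborel (\<lambda>x. c * indicator {-t..t} x)" for c :: real
      using t by auto
    have "(LINT x|lborel. std_normal_density t * indicator {-t..t} x) \<le> abs_normal_prod_cdf 1 t"
      unfolding cdf[OF t]
    proof (rule integral_mono)
      show "std_normal_density t * indicator {-t..t} x \<le> std_normal_density x * indicator {-t..t} x" for x
        using std_normal_density_antimono[of x t] by (auto simp: indicator_def)
    qed (rule int', rule integrable_std_normal_density_indicator, simp)
    then have 1: "2 * t * std_normal_density t \<le> abs_normal_prod_cdf 1 t" unfolding int .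
    have "abs_normal_prod_cdf 1 t \<le> (LINT x|lborel. std_normal_density 0 * indicator {-t..t} x)"
      unfolding cdf[OF t]
    proof (rule integral_mono)
      show "std_normal_density x * indicator {-t..t} x \<le> std_normal_density 0 * indicator {-t..t} x" for x
        using std_normal_density_antimono[of 0 x] by (auto simp: indicator_def)
    qed (rule integrable_std_normal_density_indicator, simp, rule int')
    then have 2: "abs_normal_prod_cdf 1 t \<le> 2 * t * std_normal_density 0" unfolding int .
    have "exp u = 1 / t" by (simp add: t_def exp_minus field_simps)
    then show "2 * std_normal_density (exp (- u)) \<le> abs_normal_prod_cdf 1 (exp (- u)) * exp u"
      "abs_normal_prod_cdf 1 (exp (- u)) * exp u \<le> 2 * std_normal_density 0"
      using 1 2 t unfolding t_def[symmetric]
      by (simp_all add: pos_le_divide_eq pos_divide_le_eq mult_ac del: abs_normal_prod_cdf.simps One_nat_def)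
  qed
  have "((\<lambda>u. 2 * std_normal_density (exp (- u))) \<longlongrightarrow> 2 * std_normal_density 0) at_top"
    by (intro tendsto_mult tendsto_const tendsto_std_normal_density) real_asymp
  then have "((\<lambda>u. abs_normal_prod_cdf 1 (exp (- u)) * exp u) \<longlongrightarrow> 2 * std_normal_density 0) at_top"
    by (rule tendsto_sandwich[rotated 2, OF _ tendsto_const]) (intro always_eventually allI low up)+
  then show ?thesis by (simp add: std_normal_density_def)
qed

text \<open>Substituting \<open>x = exp (u * (s - 1))\<close> in the recursion rescales the convolution by \<open>u\<close>; the
  integrands then converge to a multiple of \<open>s ^ m\<close> on \<open>[0, 1]\<close> and to \<open>0\<close> elsewhere.\<close>

lemma abs_normal_prod_cdf_asymp:
  "((\<lambda>u. abs_normal_prod_cdf (Suc m) (exp (- u)) * exp u / u ^ m) \<longlongrightarrow> (2 / sqrt (2 * pi)) ^ Suc m / fact m) at_top"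
proof (induction m)
  case 0
  then show ?case using abs_normal_prod_cdf_1_asymp by simp
next
  case (Suc m)
  define c where "c = 2 / sqrt (2 * pi)"
  define l where "l = c ^ Suc m / fact m"
  define F where "F = abs_normal_prod_cdf (Suc m)"
  have F: "0 \<le> F t" "F t \<le> 1" for t by (simp_all add: F_def del: abs_normal_prod_cdf.simps)
  have [measurable]: "F \<in> borel_measurable borel" by (simp add: F_def del: abs_normal_prod_cdf.simps)
  have IH: "((\<lambda>u. F (exp (- u)) * exp u / u ^ m) \<longlongrightarrow> l) at_top"
    using Suc unfolding F_def l_def c_def .
  have small: "p * (q * r) \<le> r" if "0 \<le> p" "p \<le> 1" "0 \<le> q" "q \<le> 1" "0 \<le> r" for p q r :: real
    using mult_mono[of p 1 "q * r" "1 * r"] mult_right_mono[of q 1 r] that by simp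
  have c0: "std_normal_density 0 = c / 2" by (simp add: std_normal_density_def c_def)
  \<comment> \<open>A bound on the whole half-line, as domination requires: the induction hypothesis
    provides it for large \<open>v\<close>, and \<open>F \<le> 1\<close> on the remaining bounded
    range. The power is of \<open>1 + v\<close> because \<open>v ^ m\<close> may vanish at
    0.\<close>
  obtain C where C: "0 < C" "\<And>v. 0 \<le> v \<Longrightarrow> F (exp (- v)) * exp v \<le> C * (1 + v) ^ m"
  proof -
    have "eventually (\<lambda>v. F (exp (- v)) * exp v / v ^ m < l + 1) at_top"
      using IH by (rule order_tendstoD) simp
    then obtain v0 where v0: "\<And>v. v0 \<le> v \<Longrightarrow> F (exp (- v)) * exp v / v ^ m < l + 1"
      by (auto simp: eventually_at_top_linorder)
    define v1 where "v1 = max v0 1"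
    define C where "C = max (l + 1) (exp v1)"
    have C: "0 < C" by (simp add: C_def less_max_iff_disj)
    have "F (exp (- v)) * exp v \<le> C * (1 + v) ^ m" if v: "0 \<le> v" for v
    proof (cases "v1 \<le> v")
      case True
      then have pos: "0 < v" "v0 \<le> v" by (auto simp: v1_def)
      then have "F (exp (- v)) * exp v \<le> (l + 1) * v ^ m"
        using v0[of v] by (simp add: field_simps)
      also have "\<dots> \<le> C * v ^ m" using pos by (intro mult_right_mono) (auto simp: C_def)
      also have "\<dots> \<le> C * (1 + v) ^ m" using pos C by (intro mult_left_mono power_mono) auto
      finally show ?thesis .
    next
      case False
      have "F (exp (- v)) * exp v \<le> 1 * exp v1"
        using F False by (intro mult_mono) auto
      also have "\<dots> \<le> C * 1" by (simp add: C_def)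
      also have "\<dots> \<le> C * (1 + v) ^ m" using v C by (intro mult_left_mono one_le_power) auto
      finally show ?thesis .
    qed
    with C that show thesis by blast
  qed
  \<comment> \<open>What remains of the substituted integrand once
    \<open>u ^ Suc m * exp (- u)\<close> is taken out; that factor cancels the normalisation of the
    claim.\<close>
  define K where "K u s = std_normal_density (exp (u * (s - 1))) * (F (exp (- (u * s))) * exp (u * s) / u ^ m)" for u s :: real
  \<comment> \<open>For \<open>0 < s < 1\<close> the argument of the density tends to 0, where its
    value is \<open>c / 2\<close>; for \<open>s > 1\<close> it tends to infinity. For negative
    \<open>s\<close> the factor \<open>exp (u * s)\<close> gives the limit 0.\<close>
  define k where "k s = c / 2 * l * (s ^ m * indicator {0..1} s)" for s :: real
  have eq: "abs_normal_prod_cdf (Suc (Suc m)) (exp (- u)) * exp u / u ^ Suc m = 2 * (LINT s|lborel. K u s)"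
    if u: "0 < u" for u
  proof -
    have "abs_normal_prod_cdf (Suc (Suc m)) (exp (- u)) = (LINT x|std_normal_distribution. F (exp (- u) / \<bar>x\<bar>))"
      unfolding F_def by (rule abs_normal_prod_cdf.simps)
    also have "\<dots> = 2 * (LINT s|lborel. u * exp (u * (s - 1)) * (std_normal_density (exp (u * (s - 1))) * F (exp (- u) / exp (u * (s - 1)))))"
      using F by (intro std_normal_integral_exp_substitution[OF u, where h="\<lambda>x. F (exp (- u) / x)"]) auto
    also have "\<dots> = 2 * (LINT s|lborel. (u ^ Suc m * exp (- u)) * K u s)"
    proof (intro arg_cong[where f="\<lambda>x. 2 * x"] Bochner_Integration.integral_cong refl)
      fix s :: real
      have "exp (- u) / exp (u * (s - 1)) = exp (- (u * s))"
        by (simp add: exp_diff[symmetric] algebra_simps)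
      moreover have "u * exp (u * (s - 1)) = (u ^ Suc m * exp (- u)) * (exp (u * s) / u ^ m)"
        using u by (simp add: exp_diff exp_minus right_diff_distrib field_simps)
      ultimately show "u * exp (u * (s - 1)) * (std_normal_density (exp (u * (s - 1))) * F (exp (- u) / exp (u * (s - 1)))) =
          (u ^ Suc m * exp (- u)) * K u s"
        unfolding K_def by (simp only: mult_ac times_divide_eq_right times_divide_eq_left)
    qed
    also have "\<dots> = 2 * ((u ^ Suc m * exp (- u)) * (LINT s|lborel. K u s))" by simp
    finally have *: "abs_normal_prod_cdf (Suc (Suc m)) (exp (- u)) = 2 * ((u ^ Suc m * exp (- u)) * (LINT s|lborel. K u s))" .
    have cancel: "(2 * ((p * q) * I)) * r / p = 2 * I" if "p \<noteq> 0" "q * r = 1" for p q r I :: real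
    proof -
      have "(2 * ((p * q) * I)) * r / p = 2 * I * (q * r)" using that(1) by (simp add: field_simps)
      then show ?thesis using that(2) by simp
    qed
    show ?thesis
      unfolding * by (rule cancel) (use u in \<open>auto simp: exp_minus\<close>)
  qed
  have F_lim: "((\<lambda>u. F (exp (- (u * s))) * exp (u * s) / u ^ m) \<longlongrightarrow> s ^ m * l) at_top" if s: "0 < s" for s
  proof -
    have us: "filterlim (\<lambda>u. u * s) at_top at_top" using s by real_asymp
    have "((\<lambda>u. s ^ m * (F (exp (- (u * s))) * exp (u * s) / (u * s) ^ m)) \<longlongrightarrow> s ^ m * l) at_top"
      by (intro tendsto_mult tendsto_const filterlim_compose[OF IH us])
    moreover have "s ^ m * (F (exp (- (u * s))) * exp (u * s) / (u * s) ^ m) = F (exp (- (u * s))) * exp (u * s) / u ^ m" for u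
      using s by (simp add: power_mult_distrib)
    ultimately show ?thesis by simp
  qed
  have "((\<lambda>u. LINT s|lborel. K u s) \<longlongrightarrow> (LINT s|lborel. k s)) at_top"
  proof (rule integral_dominated_convergence_at_top)
    \<comment> \<open>One majorant for both signs of \<open>s\<close>. For \<open>s \<le> 0\<close>
      the decay comes from \<open>exp (u * s)\<close> with \<open>u \<ge> 1\<close>. For
      \<open>s > 0\<close> the growth \<open>(1 + s) ^ m\<close> is at most
      \<open>fact m * 2 ^ m * exp ((1 + s) / 2)\<close>, and the density contributes
      \<open>exp (1 - s)\<close>; together they decay like
      \<open>exp (3 / 2 - s / 2)\<close>.\<close>
    let ?w = "\<lambda>s. (1 + C * fact m * 2 ^ m) * exp 2 * exp (- \<bar>s\<bar> / 2)"
    show "k \<in> borel_measurable lborel" unfolding k_def by measurable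
    show "K u \<in> borel_measurable lborel" for u unfolding K_def by measurable
    show "integrable lborel ?w" using integrable_exp_minus_abs by simp
    show "AE s in lborel. ((\<lambda>u. K u s) \<longlongrightarrow> k s) at_top"
      using AE_lborel_singleton[of 0] AE_lborel_singleton[of 1]
    proof eventually_elim
      case (elim s)
      consider "s < 0" | "0 < s" "s < 1" | "1 < s" using elim by linarith
      then show ?case
      proof cases
        case 1
        have "((\<lambda>u. exp (u * s) / u ^ m) \<longlongrightarrow> 0) at_top" using 1 by real_asymp
        moreover have "\<forall>\<^sub>F u in at_top. norm (K u s) \<le> exp (u * s) / u ^ m"
          using eventually_gt_at_top[of 0]
        proof eventually_elim
          case (elim u)
          have "norm (K u s) = std_normal_density (exp (u * (s - 1))) * (F (exp (- (u * s))) * (exp (u * s) / u ^ m))"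
            using F elim by (simp add: K_def)
          also have "\<dots> \<le> exp (u * s) / u ^ m"
            by (rule small) (use F std_normal_density_le_1 elim in auto)
          finally show ?case .
        qed
        ultimately have "((\<lambda>u. K u s) \<longlongrightarrow> 0) at_top" by (rule Lim_null_comparison[rotated])
        then show ?thesis using 1 by (simp add: k_def)
      next
        case 2
        note F_lim[OF 2(1)]
        moreover have "((\<lambda>u. std_normal_density (exp (u * (s - 1)))) \<longlongrightarrow> c / 2) at_top"
        proof -
          have "((\<lambda>u. std_normal_density (exp (u * (s - 1)))) \<longlongrightarrow> std_normal_density 0) at_top"
            by (intro tendsto_std_normal_density) (use 2 in real_asymp)
          then show ?thesis by (simp only: c0)
        qed
        ultimately have "((\<lambda>u. K u s) \<longlongrightarrow> c / 2 * (s ^ m * l)) at_top" unfolding K_def by (intro tendsto_mult)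
        then show ?thesis using 2 by (simp add: k_def mult_ac)
      next
        case 3
        have "0 < s" using 3 by simp
        note F_lim[OF this]
        moreover have "((\<lambda>u. std_normal_density (exp (u * (s - 1)))) \<longlongrightarrow> 0) at_top"
          unfolding std_normal_density_def using 3 by real_asymp
        ultimately have "((\<lambda>u. K u s) \<longlongrightarrow> 0 * (s ^ m * l)) at_top" unfolding K_def by (intro tendsto_mult)
        then show ?thesis using 3 by (simp add: k_def)
      qed
    qed
    show "\<forall>\<^sub>F u in at_top. AE s in lborel. norm (K u s) \<le> ?w s"
      using eventually_ge_at_top[of 1]
    proof eventually_elim
      case (elim u)
      have w: "?w s = (1 + C * fact m * 2 ^ m) * exp (2 + - \<bar>s\<bar> / 2)" for s
        by (simp only: exp_add mult.assoc)
      have "norm (K u s) \<le> ?w s" for s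
      proof (cases "s \<le> 0")
        case True
        have "norm (K u s) = std_normal_density (exp (u * (s - 1))) * (F (exp (- (u * s))) * (exp (u * s) / u ^ m))"
          using F elim by (simp add: K_def)
        also have "\<dots> \<le> exp (u * s) / u ^ m"
          by (rule small) (use F std_normal_density_le_1 elim in auto)
        also have "\<dots> \<le> exp (u * s)"
          using one_le_power[OF elim, of m] by (simp add: divide_le_eq mult_le_cancel_left1)
        also have "\<dots> \<le> exp (2 + - \<bar>s\<bar> / 2)"
        proof -
          have "u * s \<le> 1 * s" using True elim by (intro mult_right_mono_neg) auto
          then show ?thesis using True by simp
        qed
        also have "\<dots> \<le> (1 + C * fact m * 2 ^ m) * exp (2 + - \<bar>s\<bar> / 2)"
          using C by (simp add: mult_le_cancel_right1)
        finally show ?thesis unfolding w .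
      next
        case False
        then have s: "0 < s" by simp
        have "F (exp (- (u * s))) * exp (u * s) \<le> C * (1 + u * s) ^ m"
          using C(2)[of "u * s"] s elim by simp
        also have "\<dots> \<le> C * (u * (1 + s)) ^ m"
          using C s elim by (intro mult_left_mono power_mono) (auto simp: distrib_left)
        finally have "F (exp (- (u * s))) * exp (u * s) / u ^ m \<le> C * (1 + s) ^ m"
          unfolding power_mult_distrib using elim by (subst pos_divide_le_eq) (auto simp: mult_ac)
        also have "\<dots> \<le> C * (fact m * 2 ^ m * exp ((1 + s) / 2))"
        proof -
          have "((1 + s) / 2) ^ m / fact m \<le> exp ((1 + s) / 2)"
            using s by (intro power_div_fact_le_exp) auto
          then show ?thesis using C by (simp add: power_divide field_simps)
        qed
        finally have 1: "F (exp (- (u * s))) * exp (u * s) / u ^ m \<le> C * (fact m * 2 ^ m * exp ((1 + s) / 2))" .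
        have 2: "std_normal_density (exp (u * (s - 1))) \<le> exp (1 - s)"
        proof (cases "s \<le> 1")
          case True
          have "std_normal_density (exp (u * (s - 1))) \<le> 1" by (rule std_normal_density_le_1)
          also have "1 \<le> exp (1 - s)" using True by simp
          finally show ?thesis .
        next
          case False
          \<comment> \<open>For \<open>s > 1\<close> the argument of the density is at least
            \<open>s\<close>, and the elementary inequality
            \<open>2 * (s - 1) \<le> s\<^sup>2\<close> weakens Gaussian decay to the exponential
            decay wanted.\<close>
          have "s \<le> exp (s - 1)" using exp_ge_add_one_self[of "s - 1"] by simp
          also have "s - 1 \<le> u * (s - 1)" using elim False by (simp add: mult_le_cancel_right1)
          then have "exp (s - 1) \<le> exp (u * (s - 1))" by simp
          finally have "s\<^sup>2 \<le> (exp (u * (s - 1)))\<^sup>2" using s by (intro power_mono) auto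
          moreover have "2 * (s - 1) \<le> s\<^sup>2" using zero_le_power2[of "s - 1"] by (simp add: power2_eq_square algebra_simps)
          ultimately have "- (exp (u * (s - 1)))\<^sup>2 / 2 \<le> 1 - s" by simp
          then have "exp (- (exp (u * (s - 1)))\<^sup>2 / 2) \<le> exp (1 - s)" by simp
          with std_normal_density_le_exp show ?thesis by (rule order_trans)
        qed
        have "norm (K u s) = K u s" using F elim by (simp add: K_def)
        also have "\<dots> \<le> exp (1 - s) * (C * (fact m * 2 ^ m * exp ((1 + s) / 2)))"
          unfolding K_def using 1 2 F elim by (intro mult_mono) auto
        also have "\<dots> = (C * fact m * 2 ^ m) * exp (3 / 2 - s / 2)"
        proof -
          have "exp (3 / 2 - s / 2) = exp (1 - s) * exp ((1 + s) / 2)"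
            unfolding exp_add[symmetric] by (rule arg_cong[where f=exp]) (simp add: field_simps)
          then show ?thesis by simp
        qed
        also have "\<dots> \<le> (1 + C * fact m * 2 ^ m) * exp (2 + - \<bar>s\<bar> / 2)"
          using C s by (intro mult_mono) auto
        finally show ?thesis unfolding w .
      qed
      then show ?case by simp
    qed
  qed
  \<comment> \<open>Integrating \<open>s ^ m\<close> over the unit interval turns
    \<open>fact m\<close> into \<open>fact (Suc m)\<close>; the factor 2 from evenness restores
    \<open>c\<close> from \<open>c / 2\<close>.\<close>
  moreover have "(LINT s|lborel. k s) = c / 2 * l / (m + 1)"
    unfolding k_def using integral_power[of 0 1 m] by simp
  ultimately have lim: "((\<lambda>u. 2 * (LINT s|lborel. K u s)) \<longlongrightarrow> 2 * (c / 2 * l / (m + 1))) at_top"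
    by (intro tendsto_mult tendsto_const) simp
  have l': "2 * (c / 2 * l / (m + 1)) = c ^ Suc (Suc m) / fact (Suc m)"
    by (simp add: l_def)
  have "\<forall>\<^sub>F u in at_top. 2 * (LINT s|lborel. K u s) = abs_normal_prod_cdf (Suc (Suc m)) (exp (- u)) * exp u / u ^ Suc m"
    using eventually_gt_at_top[of 0] by eventually_elim (rule eq[symmetric])
  from lim[unfolded l', unfolded c_def] this show ?case
    by (rule Lim_transform_eventually)
qed

text \<open>The preceding limit read at \<open>u = - ln t\<close>, which equals
  \<open>\<bar>ln t\<bar>\<close> once \<open>t < 1\<close>.\<close>

lemma abs_normal_prod_cdf_asymp_equiv:
  assumes "1 \<le> n"
  shows "abs_normal_prod_cdf n \<sim>[at_right 0]
    (\<lambda>t. (2 / sqrt (2 * pi)) ^ n * t * (\<bar>ln t\<bar> ^ (n - 1) / fact (n - 1)))"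
proof -
  obtain m where m: "n = Suc m" using assms by (cases n) auto
  define l :: real where "l = (2 / sqrt (2 * pi)) ^ Suc m / fact m"
  have l: "l \<noteq> 0" by (simp add: l_def)
  have lim: "filterlim (\<lambda>t::real. - ln t) at_top (at_right 0)" by real_asymp
  have "((\<lambda>t. abs_normal_prod_cdf n (exp (- (- ln t))) * exp (- ln t) / (- ln t) ^ m) \<longlongrightarrow> l) (at_right 0)"
    using filterlim_compose[OF abs_normal_prod_cdf_asymp lim] unfolding m l_def by simp
  moreover have "\<forall>\<^sub>F t :: real in at_right 0. t \<in> {0<..<1}"
    by (rule eventually_at_right_real) simp
  then have "\<forall>\<^sub>F t in at_right 0. abs_normal_prod_cdf n (exp (- (- ln t))) * exp (- ln t) / (- ln t) ^ m =
      abs_normal_prod_cdf n t / (t * \<bar>ln t\<bar> ^ m)"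
    by eventually_elim (simp add: exp_minus divide_simps del: abs_normal_prod_cdf.simps)
  ultimately have "((\<lambda>t. abs_normal_prod_cdf n t / (t * \<bar>ln t\<bar> ^ m)) \<longlongrightarrow> l) (at_right 0)"
    by (rule Lim_transform_eventually)
  then have "abs_normal_prod_cdf n \<sim>[at_right 0] (\<lambda>t. l * (t * \<bar>ln t\<bar> ^ m))"
    using l by (rule asymp_equivI'_const)
  then show ?thesis unfolding m l_def by (simp add: mult_ac)
qed

section \<open>Small ball probability of the leading minor\<close>

text \<open>The lower bounds \<open>d k\<close> hold for all coefficients \<open>\<alpha>\<close>
  because the regression supplies coefficients that are not known in advance. The threshold
  \<open>e\<close> varies because the induction hypothesis is applied at values depending on the
  normal coordinate.\<close>

lemma (in prob_space) prob_leading_minor_le: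
  fixes \<tau> :: "nat \<times> nat \<Rightarrow> 'a \<Rightarrow> real" and d :: "nat \<Rightarrow> real"
  assumes "jointly_gaussian M ({1..m} \<times> {1..m}) \<tau>"
    and "\<And>p. p \<in> {1..m} \<times> {1..m} \<Longrightarrow> expectation (\<tau> p) = 0"
    and "\<And>k. k \<in> {1..m} \<Longrightarrow> 0 < d k"
    and "\<And>k \<alpha>. k \<in> {1..m} \<Longrightarrow> d k \<le>
      expectation (\<lambda>x. (\<tau> (k, k) x - (\<Sum>p\<in>{1..k} \<times> {1..k} - {(k, k)}. \<alpha> p * \<tau> p x))\<^sup>2)"
  shows "prob {x \<in> space M. \<bar>leading_minor m (\<lambda>p. \<tau> p x)\<bar> \<le> e} \<le> abs_normal_prod_cdf m (e / (\<Prod>i=1..m. sqrt (d i)))"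
  using assms
proof (induction m arbitrary: e)
  case 0
  then show ?case using prob_space by (auto simp: leading_minor_def)
next
  case (Suc m)
  note d_pos = Suc.prems(3)
  define k where "k = Suc m"
  define J where "J = {1..k} \<times> {1..k}"
  define I where "I = J - {(k, k)}"
  have J: "finite J" "insert (k, k) I = J" "(k, k) \<notin> I" "finite I"
    by (auto simp: J_def I_def k_def)
  have sub: "{1..m} \<times> {1..m} \<subseteq> J" "{1..m} \<times> {1..m} \<subseteq> I" by (auto simp: J_def I_def k_def)
  have IH: "prob {x \<in> space M. \<bar>leading_minor m (\<lambda>p. \<tau> p x)\<bar> \<le> e'} \<le>
      abs_normal_prod_cdf m (e' / (\<Prod>i=1..m. sqrt (d i)))" for e'
  proof (rule Suc.IH)
    show "jointly_gaussian M ({1..m} \<times> {1..m}) \<tau>"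
      using jointly_gaussian_subset[OF Suc.prems(1)] sub(1) by (simp add: J_def k_def)
  qed (use Suc.prems in auto)
  interpret S: prob_space std_normal_distribution by (rule prob_space_std_normal)
  interpret P: pair_prob_space std_normal_distribution M ..
  have \<tau>_meas: "\<tau> i \<in> borel_measurable M" if "i \<in> J" for i
    using jointly_gaussian_measurable[OF Suc.prems(1)] that unfolding J_def k_def by simp
  obtain \<alpha> where \<alpha>: "distr M (Pi\<^sub>M J (\<lambda>_. borel)) (\<lambda>x. \<lambda>i\<in>J. \<tau> i x) =
     distr (std_normal_distribution \<Otimes>\<^sub>M M) (Pi\<^sub>M J (\<lambda>_. borel))
       (\<lambda>y. \<lambda>i\<in>J. if i = (k, k)
          then sqrt (expectation (\<lambda>x. (\<tau> (k, k) x - (\<Sum>i\<in>I. \<alpha> i * \<tau> i x))\<^sup>2)) * fst y + (\<Sum>i\<in>I. \<alpha> i * \<tau> i (snd y))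
          else \<tau> i (snd y))"
  proof (rule gaussian_regression[OF J(4,3), of \<tau>, unfolded J(2)])
    show "jointly_gaussian M J \<tau>" using Suc.prems(1) by (simp add: J_def k_def)
    show "expectation (\<tau> i) = 0" if "i \<in> J" for i using Suc.prems(2) that by (simp add: J_def k_def)
  qed
  define D where "D = expectation (\<lambda>x. (\<tau> (k, k) x - (\<Sum>i\<in>I. \<alpha> i * \<tau> i x))\<^sup>2)"
  have D: "0 < d k" "d k \<le> D"
    unfolding D_def I_def J_def k_def using Suc.prems(3,4)[of "Suc m"] by auto
  define L where "L x = (\<Sum>i\<in>I. \<alpha> i * \<tau> i x)" for x
  define W where "W y = (\<lambda>i\<in>J. if i = (k, k) then sqrt D * fst y + L (snd y) else \<tau> i (snd y))" for y :: "real \<times> 'a"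
  define a where "a x = leading_minor m (\<lambda>p. \<tau> p x)" for x
  \<comment> \<open>The part of the minor without the fresh normal coordinate: the predictor of the
    corner times its cofactor, plus the minor with the corner set to 0.\<close>
  define b where "b x = L x * a x + leading_minor k ((\<lambda>p. \<tau> p x)((k, k) := 0))" for x
  have minor_W: "leading_minor k (W y) = (sqrt D * a (snd y)) * fst y + b (snd y)" for y
  proof -
    have "leading_minor k (W y) = W y (k, k) * leading_minor m (W y) + leading_minor k ((W y)((k, k) := 0))"
      unfolding k_def by (rule leading_minor_Suc)
    also have "leading_minor m (W y) = a (snd y)"
      unfolding a_def by (rule leading_minor_cong) (auto simp: W_def J_def k_def)
    also have "leading_minor k ((W y)((k, k) := 0)) = leading_minor k ((\<lambda>p. \<tau> p (snd y))((k, k) := 0))"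
      by (rule leading_minor_cong) (auto simp: W_def J_def)
    also have "W y (k, k) = sqrt D * fst y + L (snd y)"
      by (simp add: W_def J_def k_def)
    finally show ?thesis by (simp add: b_def algebra_simps fun_upd_def)
  qed
  have V_meas [measurable]: "(\<lambda>x. \<lambda>i\<in>J. \<tau> i x) \<in> measurable M (Pi\<^sub>M J (\<lambda>_. borel))"
    using \<tau>_meas by (auto intro: measurable_restrict)
  have fst_meas [measurable]: "fst \<in> borel_measurable (std_normal_distribution \<Otimes>\<^sub>M M)"
    using measurable_fst[of std_normal_distribution M] by (simp cong: measurable_cong_sets)
  have [measurable]: "L \<in> borel_measurable M"
    unfolding L_def[abs_def] using \<tau>_meas by (intro borel_measurable_sum borel_measurable_times) (auto simp: I_def)
  have W_meas [measurable]: "W \<in> measurable (std_normal_distribution \<Otimes>\<^sub>M M) (Pi\<^sub>M J (\<lambda>_. borel))"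
    unfolding W_def[abs_def]
  proof (rule measurable_restrict)
    fix i assume "i \<in> J"
    then have [measurable]: "\<tau> i \<in> borel_measurable M" by (rule \<tau>_meas)
    show "(\<lambda>y. if i = (k, k) then sqrt D * fst y + L (snd y) else \<tau> i (snd y)) \<in> borel_measurable (std_normal_distribution \<Otimes>\<^sub>M M)"
      by measurable
  qed
  have [measurable]: "leading_minor k \<in> borel_measurable (Pi\<^sub>M J (\<lambda>_. borel))"
    by (intro borel_measurable_leading_minor equalityD1[OF J_def[symmetric]])
  have [measurable]: "a \<in> borel_measurable M"
    unfolding a_def[abs_def] by (intro borel_measurable_leading_minor_family \<tau>_meas subsetD[OF sub(1)])
  show ?case
  \<comment> \<open>For negative \<open>e\<close> the event is empty. Otherwise replacing
    \<open>sqrt D\<close> by the smaller \<open>sqrt (d k)\<close> can only increase the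
    threshold.\<close>
  proof (cases "e < 0")
    case True
    then have "{x \<in> space M. \<bar>leading_minor (Suc m) (\<lambda>p. \<tau> p x)\<bar> \<le> e} = {}" by auto
    then show ?thesis by (simp only: measure_empty abs_normal_prod_cdf_nonneg)
  next
    case False
    define S0 where "S0 = {f \<in> space (Pi\<^sub>M J (\<lambda>_. borel)). \<bar>leading_minor k f\<bar> \<le> e}"
    have S0: "S0 \<in> sets (Pi\<^sub>M J (\<lambda>_. borel))" unfolding S0_def by measurable
    define S1 where "S1 = {y \<in> space (std_normal_distribution \<Otimes>\<^sub>M M). \<bar>(sqrt D * a (snd y)) * fst y + b (snd y)\<bar> \<le> e}"
    define S2 where "S2 = {y \<in> space (std_normal_distribution \<Otimes>\<^sub>M M). \<bar>(sqrt D * a (snd y)) * fst y\<bar> \<le> e}"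
    have S1_eq: "W -` S0 \<inter> space (std_normal_distribution \<Otimes>\<^sub>M M) = S1"
      using measurable_space[OF W_meas] by (auto simp: S0_def S1_def minor_W)
    have S1: "S1 \<in> sets (std_normal_distribution \<Otimes>\<^sub>M M)"
      using measurable_sets[OF W_meas S0] unfolding S1_eq .
    have S2: "S2 \<in> sets (std_normal_distribution \<Otimes>\<^sub>M M)"
      unfolding S2_def by measurable
    have "{x \<in> space M. \<bar>leading_minor k (\<lambda>p. \<tau> p x)\<bar> \<le> e} = (\<lambda>x. \<lambda>i\<in>J. \<tau> i x) -` S0 \<inter> space M"
    proof -
      have "leading_minor k (\<lambda>i\<in>J. \<tau> i x) = leading_minor k (\<lambda>p. \<tau> p x)" for x
        by (rule leading_minor_cong) (auto simp: J_def)
      then show ?thesis using measurable_space[OF V_meas] by (auto simp: S0_def)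
    qed
    then have "prob {x \<in> space M. \<bar>leading_minor k (\<lambda>p. \<tau> p x)\<bar> \<le> e} =
        measure (distr M (Pi\<^sub>M J (\<lambda>_. borel)) (\<lambda>x. \<lambda>i\<in>J. \<tau> i x)) S0"
      using S0 by (simp add: measure_distr)
    also have "\<dots> = measure (distr (std_normal_distribution \<Otimes>\<^sub>M M) (Pi\<^sub>M J (\<lambda>_. borel)) W) S0"
      unfolding \<alpha> W_def[abs_def] D_def L_def ..
    also have "\<dots> = measure (std_normal_distribution \<Otimes>\<^sub>M M) S1"
      using S0 S1_eq by (simp add: measure_distr)
    also have "\<dots> = (LINT x|M. measure std_normal_distribution ((\<lambda>r. (r, x)) -` S1))"
      by (rule P.measure_pair_eq_integral(2)[OF S1])
    also have "\<dots> \<le> (LINT x|M. measure std_normal_distribution ((\<lambda>r. (r, x)) -` S2))"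
    proof (rule integral_mono[OF P.measure_pair_eq_integral(4)[OF S1] P.measure_pair_eq_integral(4)[OF S2]])
      fix x assume "x \<in> space M"
      then have "(\<lambda>r. (r, x)) -` S1 = {r. \<bar>(sqrt D * a x) * r + b x\<bar> \<le> e}"
        "(\<lambda>r. (r, x)) -` S2 = {r. \<bar>(sqrt D * a x) * r\<bar> \<le> e}"
        by (auto simp: S1_def S2_def space_pair_measure)
      then show "measure std_normal_distribution ((\<lambda>r. (r, x)) -` S1) \<le> measure std_normal_distribution ((\<lambda>r. (r, x)) -` S2)"
        using measure_std_normal_affine_le by simp
    qed
    \<comment> \<open>The order of integration is exchanged: with \<open>r\<close> fixed,
      \<open>S2\<close> only restricts the size of the minor \<open>a\<close> of order
      \<open>m\<close>.\<close>
    also have "\<dots> = (LINT r|std_normal_distribution. prob (Pair r -` S2))"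
      using P.measure_pair_eq_integral(1,2)[OF S2] by simp
    also have "\<dots> \<le> (LINT r|std_normal_distribution. abs_normal_prod_cdf m (e / (\<Prod>i=1..k. sqrt (d i)) / \<bar>r\<bar>))"
    proof (rule integral_mono_AE[OF P.measure_pair_eq_integral(3)[OF S2]])
      show "AE r in std_normal_distribution. prob (Pair r -` S2) \<le> abs_normal_prod_cdf m (e / (\<Prod>i=1..k. sqrt (d i)) / \<bar>r\<bar>)"
        using AE_std_normal_nonzero
      proof eventually_elim
        case (elim r)
        have pos: "0 < sqrt (d k)" "sqrt (d k) \<le> sqrt D" "0 < sqrt D" using D by auto
        have prod_pos: "0 < (\<Prod>i=1..m. sqrt (d i))" using d_pos by (intro prod_pos) auto
        have "Pair r -` S2 = {x \<in> space M. \<bar>a x\<bar> \<le> e / (sqrt D * \<bar>r\<bar>)}"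
          using elim pos by (auto simp: S2_def space_pair_measure abs_mult field_simps)
        then have "prob (Pair r -` S2) \<le> abs_normal_prod_cdf m (e / (sqrt D * \<bar>r\<bar>) / (\<Prod>i=1..m. sqrt (d i)))"
          using IH unfolding a_def by (simp only:)
        also have "\<dots> \<le> abs_normal_prod_cdf m (e / (\<Prod>i=1..k. sqrt (d i)) / \<bar>r\<bar>)"
        proof (rule abs_normal_prod_cdf_mono)
          have "e / (sqrt D * \<bar>r\<bar>) / (\<Prod>i=1..m. sqrt (d i)) = e / (sqrt D * (\<bar>r\<bar> * (\<Prod>i=1..m. sqrt (d i))))"
            by (simp add: mult.assoc)
          also have "\<dots> \<le> e / (sqrt (d k) * (\<bar>r\<bar> * (\<Prod>i=1..m. sqrt (d i))))"
            using False elim pos prod_pos by (intro divide_left_mono mult_right_mono mult_pos_pos) auto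
          also have "\<dots> = e / (\<Prod>i=1..k. sqrt (d i)) / \<bar>r\<bar>"
            by (simp add: k_def mult_ac)
          finally show "e / (sqrt D * \<bar>r\<bar>) / (\<Prod>i=1..m. sqrt (d i)) \<le> e / (\<Prod>i=1..k. sqrt (d i)) / \<bar>r\<bar>" .
        qed
        finally show ?case .
      qed
    qed (intro integrable_abs_normal_prod_cdf, measurable)
    finally show ?thesis by (simp only: k_def abs_normal_prod_cdf.simps)
  qed
qed

text \<open>Every pair of the block other than its corner is a hook index, so extending
  \<open>\<alpha>\<close> by zero gives a family with finite support that competes in the infimum;
  the values are bounded below by 0.\<close>

lemma hook_dist_le:
  assumes "k \<le> n"
  shows "hook_dist M n \<tau> k \<le> integral\<^sup>L M (\<lambda>\<omega>. (\<tau> k k \<omega> -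
    (\<Sum>p\<in>{1..k} \<times> {1..k} - {(k, k)}. \<alpha> p * (case p of (i, j) \<Rightarrow> \<tau> i j) \<omega>))\<^sup>2)"
proof -
  let ?I = "{1..k} \<times> {1..k} - {(k, k)}"
  define \<beta> where "\<beta> p = (if p \<in> ?I then \<alpha> p else 0)" for p
  have sub: "?I \<subseteq> hook_indices n k"
    using assms by (auto simp: hook_indices_def)
  have supp: "{p \<in> hook_indices n k. \<beta> p \<noteq> 0} \<subseteq> ?I"
    unfolding \<beta>_def by (auto split: if_splits)
  then have fin: "finite {p \<in> hook_indices n k. \<beta> p \<noteq> 0}"
    by (rule finite_subset) auto
  have sum: "(\<Sum>(i, j)\<in>{p \<in> hook_indices n k. \<beta> p \<noteq> 0}. \<beta> (i, j) * \<tau> i j \<omega>) =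
      (\<Sum>p\<in>?I. \<alpha> p * (case p of (i, j) \<Rightarrow> \<tau> i j) \<omega>)" for \<omega>
  proof (rule sum.mono_neutral_cong_left[OF _ supp])
    show "\<forall>p\<in>?I - {p \<in> hook_indices n k. \<beta> p \<noteq> 0}. \<alpha> p * (case p of (i, j) \<Rightarrow> \<tau> i j) \<omega> = 0"
      using sub by (auto simp: \<beta>_def)
  qed (use supp in \<open>auto simp: \<beta>_def split: if_splits\<close>)
  show ?thesis
    unfolding hook_dist_def sum[symmetric]
  proof (rule cINF_lower)
    show "\<beta> \<in> {\<alpha>. finite {p \<in> hook_indices n k. \<alpha> p \<noteq> 0}}" using fin by blast
  qed (intro bdd_belowI2[where m=0] Bochner_Integration.integral_nonneg zero_le_power2)
qed

theorem corollary1p3: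
  fixes M :: "'a measure" and N :: "'b measure"
    and n :: nat
    and \<tau> :: "nat \<Rightarrow> nat \<Rightarrow> 'a \<Rightarrow> real"
    and X :: "nat \<Rightarrow> 'b \<Rightarrow> real"
    and d :: "nat \<Rightarrow> real" and \<epsilon>\<^sub>0 :: "real \<Rightarrow> real"
  defines "d \<equiv> hook_dist M n \<tau>"
    and "\<epsilon>\<^sub>0 \<equiv> (\<lambda>\<epsilon>. \<epsilon> / (\<Prod>i=1..n. sqrt (d i)))"
  assumes n: "1 \<le> n"
    and M: "prob_space M"
    and gaussian: "jointly_gaussian M ({1..n} \<times> {1..}) (\<lambda>(i, j). \<tau> i j)"
    and centered: "\<And>i j. i \<in> {1..n} \<Longrightarrow> 1 \<le> j \<Longrightarrow> integral\<^sup>L M (\<tau> i j) = 0"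
    and square_summable: "AE \<omega> in M. \<forall>i\<in>{1..n}. summable (\<lambda>j. (\<tau> i (Suc j) \<omega>)\<^sup>2)"
    and d_pos: "\<And>k. k \<in> {1..n} \<Longrightarrow> d k > 0"
    and N: "prob_space N"
    and X_indep: "prob_space.indep_vars N (\<lambda>_. borel) X {1..n}"
    and X_normal: "\<And>j. j \<in> {1..n} \<Longrightarrow>
      distributed N lborel (X j) (\<lambda>x. ennreal (std_normal_density x))"
  shows "(\<forall>\<^sub>F \<epsilon> in at_right 0.
            measure M {\<omega> \<in> space M. sqrt (Determinant.det (gram_matrix n \<tau> \<omega>)) < \<epsilon>}
              \<le> measure N {\<omega> \<in> space N. (\<Prod>j=1..n. \<bar>X j \<omega>\<bar>) \<le> \<epsilon>\<^sub>0 \<epsilon>})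
       \<and> (\<lambda>\<epsilon>. measure N {\<omega> \<in> space N. (\<Prod>j=1..n. \<bar>X j \<omega>\<bar>) \<le> \<epsilon>\<^sub>0 \<epsilon>})
           \<sim>[at_right 0]
         (\<lambda>\<epsilon>. (2 / sqrt (2 * pi)) ^ n * \<epsilon>\<^sub>0 \<epsilon> * (\<bar>ln (\<epsilon>\<^sub>0 \<epsilon>)\<bar> ^ (n - 1) / fact (n - 1)))"
proof -
  interpret M: prob_space M by (rule M)
  interpret N: prob_space N by (rule N)
  define \<sigma> where "\<sigma> p = (case p of (i, j) \<Rightarrow> \<tau> i j)" for p
  have cdf: "measure N {\<omega> \<in> space N. (\<Prod>j=1..n. \<bar>X j \<omega>\<bar>) \<le> t} = abs_normal_prod_cdf n t" for t
    by (rule N.prob_prod_abs_normal[OF X_indep X_normal])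
  have jg: "jointly_gaussian M ({1..n} \<times> {1..n}) \<sigma>"
  proof -
    have "\<sigma> = (\<lambda>(i, j). \<tau> i j)" by (auto simp: \<sigma>_def)
    moreover have "{1..n} \<times> {1..n} \<subseteq> {1..n} \<times> {1::nat..}" by auto
    ultimately show ?thesis using jointly_gaussian_subset[OF gaussian] by simp
  qed
  have minor: "leading_minor n (\<lambda>p. \<sigma> p \<omega>) = Determinant.det (Matrix.mat n n (\<lambda>(i, j). \<tau> (Suc i) (Suc j) \<omega>))" for \<omega>
    by (simp add: leading_minor_def \<sigma>_def)
  have meas: "(\<lambda>\<omega>. leading_minor n (\<lambda>p. \<sigma> p \<omega>)) \<in> borel_measurable M"
    by (intro borel_measurable_leading_minor_family jointly_gaussian_measurable[OF jg])
  have bound: "measure M {\<omega> \<in> space M. sqrt (Determinant.det (gram_matrix n \<tau> \<omega>)) < \<epsilon>}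
      \<le> measure N {\<omega> \<in> space N. (\<Prod>j=1..n. \<bar>X j \<omega>\<bar>) \<le> \<epsilon>\<^sub>0 \<epsilon>}" if \<epsilon>: "0 < \<epsilon>" for \<epsilon>
  proof -
    have "measure M {\<omega> \<in> space M. sqrt (Determinant.det (gram_matrix n \<tau> \<omega>)) < \<epsilon>}
        \<le> measure M {\<omega> \<in> space M. \<bar>leading_minor n (\<lambda>p. \<sigma> p \<omega>)\<bar> \<le> \<epsilon>}"
    proof (rule M.finite_measure_mono_AE)
      show "AE \<omega> in M. \<omega> \<in> {\<omega> \<in> space M. sqrt (Determinant.det (gram_matrix n \<tau> \<omega>)) < \<epsilon>} \<longrightarrow>
          \<omega> \<in> {\<omega> \<in> space M. \<bar>leading_minor n (\<lambda>p. \<sigma> p \<omega>)\<bar> \<le> \<epsilon>}"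
        using square_summable
      proof eventually_elim
        case (elim \<omega>)
        \<comment> \<open>The comparison of determinants is used where the minor is nonzero; where
          it vanishes, the target event holds because \<open>\<epsilon>\<close> is positive.\<close>
        have "\<bar>leading_minor n (\<lambda>p. \<sigma> p \<omega>)\<bar> \<le> sqrt (Determinant.det (gram_matrix n \<tau> \<omega>))"
          if "leading_minor n (\<lambda>p. \<sigma> p \<omega>) \<noteq> 0"
        proof -
          have "(leading_minor n (\<lambda>p. \<sigma> p \<omega>))\<^sup>2 \<le> Determinant.det (gram_matrix n \<tau> \<omega>)"
            unfolding minor gram_matrix_def
            by (rule det_gram_ge_det_square) (use elim that in \<open>auto simp: minor\<close>)
          then show ?thesis using real_sqrt_le_mono by fastforce
        qed
        then show ?case using \<epsilon> by force
      qed
      show "{\<omega> \<in> space M. \<bar>leading_minor n (\<lambda>p. \<sigma> p \<omega>)\<bar> \<le> \<epsilon>} \<in> M.events"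
        using meas by measurable
    qed
    also have "\<dots> \<le> abs_normal_prod_cdf n (\<epsilon> / (\<Prod>i=1..n. sqrt (d i)))"
    proof (rule M.prob_leading_minor_le[OF jg _ d_pos])
      show "M.expectation (\<sigma> p) = 0" if "p \<in> {1..n} \<times> {1..n}" for p
        using that centered by (auto simp: \<sigma>_def)
      show "d k \<le> M.expectation (\<lambda>\<omega>. (\<sigma> (k, k) \<omega> - (\<Sum>p\<in>{1..k} \<times> {1..k} - {(k, k)}. \<alpha> p * \<sigma> p \<omega>))\<^sup>2)"
        if "k \<in> {1..n}" for k \<alpha>
        using hook_dist_le[of k n M \<tau> \<alpha>] that unfolding d_def \<sigma>_def by simp
    qed
    finally show ?thesis unfolding cdf \<epsilon>\<^sub>0_def .
  qed
  \<comment> \<open>Division by a positive constant preserves convergence to 0 from the right, so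
    the asymptotics in \<open>t\<close> may be composed with
    \<open>\<epsilon>\<^sub>0\<close>.\<close>
  have "filterlim (\<lambda>\<epsilon>. \<epsilon> / c) (at_right 0) (at_right 0)" if "0 < c" for c :: real
    using that by real_asymp
  moreover have "0 < (\<Prod>i=1..n. sqrt (d i))" using d_pos by (intro prod_pos) auto
  ultimately have "filterlim \<epsilon>\<^sub>0 (at_right 0) (at_right 0)" unfolding \<epsilon>\<^sub>0_def by blast
  from asymp_equiv_compose'[OF abs_normal_prod_cdf_asymp_equiv[OF n] this]
  show ?thesis
    unfolding cdf using bound cdf by (auto intro: eventually_at_right_less[THEN eventually_mono])
qed

end
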